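(* Let $\mathcal{A}=\{1,\dots,N\}$, $\mathcal{C}=\{1,\dots,K\}$, and consider the closed-loop system $$\dot x=-\alpha\nabla f(x+\gamma u)-\alpha(R_{\mathcal{C}}\otimes I_n)d,\qquad \dot z=\beta(R_{\mathcal{A}}\otimes I_n)^\top y,$$ with $y=x+\gamma u$, $d=z$, $u=-(R_{\mathcal{C}}\otimes I_n)d$, where $\alpha=\mathrm{diag}(\alpha_i)\otimes I_n$, $\beta=\mathrm{diag}(\beta_k)\otimes I_n$, $\gamma=\mathrm{diag}(\gamma_i)\otimes I_n$, $\alpha_i>0$, $\beta_k>0$, $\gamma_i\ge0$. Let each $f_i:\mathbb{R}^n\to\mathbb{R}$ be $m_i$-strongly convex with $M_i$-Lipschitz gradient, and let each agent be IF-OFEIP$(\nu_i,\rho_i)$ with storage function $S_i(\tilde x_i)=\frac1{2\alpha_i}\tilde x_i^\top\tilde x_i$ and indices $\nu_i=\frac12\gamma_i$, $\rho_i=m_i-\frac12\gamma_iM_i$. Assume that $R_{\mathcal{A}},R_{\mathcal{C}}\in\mathbb{R}^{N\times K}$ satisfy $\ker(R_{\mathcal{A}}^\top)=\ker(R_{\mathcal{C}}^\top)=\{\alpha1_N\mid\alpha\in\mathbb{R}\}$. Let $K_\rho=\mathrm{diag}(\rho_i)$ and $L_\nu=R_{\mathcal{C}}^\top\mathrm{diag}(\nu_i)R_{\mathcal{C}}$. If the singular matrix $$\begin{bmatrix}2K_\rho&R_{\mathcal{C}}-R_{\mathcal{A}}\\(R_{\mathcal{C}}-R_{\mathcal{A}})^\top&2L_\nu\end{bmatrix}$$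 is positive semidefinite and the matrix $\mathrm{diag}(\beta_k)\,R_{\mathcal{A}}^\top K_\rho^{-1}(R_{\mathcal{C}}-R_{\mathcal{A}})$ has only eigenvalues which are either zero or have positive real part, then the equilibrium $\bar y_i=\mathrm{y}^*$, $i\in\mathcal{A}$, is a globally asymptotically stable equilibrium point of the closed-loop system, where $\mathrm{y}^*$ is the minimizer of $\sum_{i\in\mathcal{A}}f_i$.
   Context: Here $x=\mathrm{col}(x_i)\in\mathbb{R}^{Nn}$, $z=\mathrm{col}(z_k)\in\mathbb{R}^{Kn}$, $y=\mathrm{col}(y_i)$, $u=\mathrm{col}(u_i)$, and $\nabla f(y)=\mathrm{col}(\nabla f_i(y_i))$. Agent $i$ is the system $\dot x_i=-\alpha_i\nabla f_i(x_i+\gamma_iu_i)+\alpha_iu_i$, $y_i=x_i+\gamma_iu_i$; controller $k$ is the integrator $\dot z_k=\beta_k\zeta_k$, $d_k=z_k$; they are interconnected by $u=-(R_{\mathcal{C}}\otimes I_n)d$, $\zeta=(R_{\mathcal{A}}\otimes I_n)^\top y$ (directed, non-symmetric communication). $m$-strong convexity ($m>0$) of a differentiable $f$: $(\nabla f(a)-\nabla f(b))^\top(a-b)\ge m\|a-b\|^2$ for all $a,b$. $M$-Lipschitz gradient: $\|\nabla f(a)-\nabla f(b)\|\le M\|a-b\|$. The invertibility of $K_\rho$ is implicit in the statement. IF-OFEIP$(\nu_i,\rho_i)$ with storage function $S_i$ means: for every equilibrium $(\bar x_i,\bar u_i,\bar y_i)$ of agent $i$ and all $x_i,u_i$, with $\tilde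 x_i=x_i-\bar x_i$, $\tilde u_i=u_i-\bar u_i$, $\tilde y_i=y_i-\bar y_i$, the derivative of $S_i$ along the agent dynamics satisfies $\dot S_i\le\tilde y_i^\top\tilde u_i-\nu_i\tilde u_i^\top\tilde u_i-\rho_i\tilde y_i^\top\tilde y_i$. Equilibria of the full state $(x,z)$ are in general not unique, but all of them satisfy $\bar y_i=\mathrm{y}^*$. Global asymptotic stability of $\bar y_i=\mathrm{y}^*$ means: the equilibria of the closed-loop system are Lyapunov stable and every trajectory converges with $y_i(t)\to\mathrm{y}^*$ for all $i\in\mathcal{A}$. *)

theory Defs
  imports "HOL-Analysis.Analysis"
begin

subsection \<open>Strong convexity\<close>

(* Only meaningful where f is differentiable; differentiability is part of strongly_convex
   and of IF_OFEIP below. *)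
definition gradient :: "('a::real_inner \<Rightarrow> real) \<Rightarrow> 'a \<Rightarrow> 'a" where
  "gradient f x = (THE D. GDERIV f x :> D)"

definition strongly_convex :: "real \<Rightarrow> ('a::real_inner \<Rightarrow> real) \<Rightarrow> bool" where
  "strongly_convex m f \<longleftrightarrow>
     m > 0 \<and> (\<forall>x. f differentiable (at x)) \<and>
     (\<forall>a b. (gradient f a - gradient f b) \<bullet> (a - b) \<ge> m * (norm (a - b))\<^sup>2)"

subsection \<open>Matrices\<close>

definition diag :: "'a::zero ^ 'n \<Rightarrow> 'a ^ 'n ^ 'n" where
  "diag v = (\<chi> i j. if i = j then v $ i else 0)"

(* The matrix [A, B; C, D], with rows and columns indexed by disjoint unions. *)
definition block_matrix ::
  "'a ^ 'p ^ 'r \<Rightarrow> 'a ^ 'q ^ 'r \<Rightarrow> 'a ^ 'p ^ 's \<Rightarrow> 'a ^ 'q ^ 's \<Rightarrow> 'a ^ ('p + 'q) ^ ('r + 's)" where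
  "block_matrix A B C D =
     (\<chi> i j. case i of
        Inl r \<Rightarrow> (case j of Inl p \<Rightarrow> A $ r $ p | Inr q \<Rightarrow> B $ r $ q)
      | Inr s \<Rightarrow> (case j of Inl p \<Rightarrow> C $ s $ p | Inr q \<Rightarrow> D $ s $ q))"

definition positive_semidefinite :: "real ^ 'n ^ 'n \<Rightarrow> bool" where
  "positive_semidefinite A \<longleftrightarrow> transpose A = A \<and> (\<forall>v. 0 \<le> v \<bullet> (A *v v))"

(* Eigenvalues of a real matrix are taken over the complex numbers. *)
definition complex_eigenvalue :: "real ^ 'n ^ 'n \<Rightarrow> complex \<Rightarrow> bool" where
  "complex_eigenvalue A c \<longleftrightarrow> (\<exists>v. v \<noteq> 0 \<and> map_matrix complex_of_real A *v v = c *s v)"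

(* The action of the Kronecker product of R with an identity matrix on a stacked vector col(v_k),
   represented as a vector of vectors: block i of the result is the sum over k of R_ik v_k. *)
definition kron_id_mult :: "real ^ 'k ^ 'm \<Rightarrow> 'v::real_vector ^ 'k \<Rightarrow> 'v ^ 'm" where
  "kron_id_mult R v = (\<chi> i. \<Sum>k\<in>UNIV. R $ i $ k *\<^sub>R v $ k)"

subsection \<open>Agents and their passivity\<close>

definition agent_output :: "real \<Rightarrow> 'v::real_inner \<Rightarrow> 'v \<Rightarrow> 'v" where
  "agent_output \<gamma> x u = x + \<gamma> *\<^sub>R u"

definition agent_field :: "real \<Rightarrow> real \<Rightarrow> ('v::real_inner \<Rightarrow> real) \<Rightarrow> 'v \<Rightarrow> 'v \<Rightarrow> 'v" where
  "agent_field \<alpha> \<gamma> f x u = - (\<alpha> *\<^sub>R gradient f (agent_output \<gamma> x u)) + \<alpha> *\<^sub>R u"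

(* IF-OFEIP(nu, rho) of the system x' = F x u, y = H x u with storage function S, where S is a
   function of the deviation x - xb from the equilibrium.  The left-hand side of the inequality
   is the derivative of S (x t - xb) in t along the dynamics. *)
definition IF_OFEIP ::
  "('v::real_inner \<Rightarrow> 'v \<Rightarrow> 'v) \<Rightarrow> ('v \<Rightarrow> 'v \<Rightarrow> 'v) \<Rightarrow> ('v \<Rightarrow> real) \<Rightarrow> real \<Rightarrow> real \<Rightarrow> bool" where
  "IF_OFEIP F H S \<nu> \<rho> \<longleftrightarrow>
     (\<forall>x. S differentiable (at x)) \<and>
     (\<forall>xb ub yb. F xb ub = 0 \<and> yb = H xb ub \<longrightarrow>
        (\<forall>x u. gradient S (x - xb) \<bullet> F x u
           \<le> (H x u - yb) \<bullet> (u - ub)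
             - \<nu> * ((u - ub) \<bullet> (u - ub))
             - \<rho> * ((H x u - yb) \<bullet> (H x u - yb))))"

subsection \<open>The closed loop\<close>

type_synonym ('n, 'N, 'K) state = "((real ^ 'n) ^ 'N) \<times> ((real ^ 'n) ^ 'K)"

(* The controllers are integrators with output d = z. *)
definition agent_input :: "real ^ 'K ^ 'N \<Rightarrow> ('n, 'N, 'K) state \<Rightarrow> (real ^ 'n) ^ 'N" where
  "agent_input RC s = - kron_id_mult RC (snd s)"

definition closed_loop_output ::
  "real ^ 'N \<Rightarrow> real ^ 'K ^ 'N \<Rightarrow> ('n, 'N, 'K) state \<Rightarrow> (real ^ 'n) ^ 'N" where
  "closed_loop_output \<gamma> RC s = (\<chi> i. agent_output (\<gamma> $ i) (fst s $ i) (agent_input RC s $ i))"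

definition closed_loop_field ::
  "real ^ 'N \<Rightarrow> real ^ 'K \<Rightarrow> real ^ 'N \<Rightarrow> ('N \<Rightarrow> real ^ 'n \<Rightarrow> real) \<Rightarrow>
   real ^ 'K ^ 'N \<Rightarrow> real ^ 'K ^ 'N \<Rightarrow> ('n, 'N, 'K) state \<Rightarrow> ('n, 'N, 'K) state" where
  "closed_loop_field \<alpha> \<beta> \<gamma> f RA RC s =
     ((\<chi> i. agent_field (\<alpha> $ i) (\<gamma> $ i) (f i) (fst s $ i) (agent_input RC s $ i)),
      (\<chi> k. \<beta> $ k *\<^sub>R kron_id_mult (transpose RA) (closed_loop_output \<gamma> RC s) $ k))"

subsection \<open>Stability\<close>

definition trajectory :: "('s::real_normed_vector \<Rightarrow> 's) \<Rightarrow> (real \<Rightarrow> 's) \<Rightarrow> bool" where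
  "trajectory F s \<longleftrightarrow> (\<forall>t\<ge>0. (s has_vector_derivative F (s t)) (at t within {0..}))"

definition equilibrium :: "('s::real_normed_vector \<Rightarrow> 's) \<Rightarrow> 's \<Rightarrow> bool" where
  "equilibrium F e \<longleftrightarrow> F e = 0"

definition lyapunov_stable :: "('s::real_normed_vector \<Rightarrow> 's) \<Rightarrow> 's \<Rightarrow> bool" where
  "lyapunov_stable F e \<longleftrightarrow>
     (\<forall>\<epsilon>>0. \<exists>\<delta>>0. \<forall>s. trajectory F s \<and> dist (s 0) e < \<delta> \<longrightarrow> (\<forall>t\<ge>0. dist (s t) e < \<epsilon>))"

(* Global asymptotic stability of the output value h = y for s' = F s.  Equilibria need not be
   unique, so a trajectory is required to converge to some equilibrium, depending on the
   trajectory, whereas its output converges to the prescribed value y. *)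
definition globally_asymptotically_stable_output ::
  "('s::real_normed_vector \<Rightarrow> 's) \<Rightarrow> ('s \<Rightarrow> 'y::topological_space) \<Rightarrow> 'y \<Rightarrow> bool" where
  "globally_asymptotically_stable_output F h y \<longleftrightarrow>
     (\<exists>e. equilibrium F e) \<and>
     (\<forall>e. equilibrium F e \<longrightarrow> h e = y \<and> lyapunov_stable F e) \<and>
     (\<forall>s. trajectory F s \<longrightarrow>
        (\<exists>e. equilibrium F e \<and> (s \<longlongrightarrow> e) at_top) \<and> ((\<lambda>t. h (s t)) \<longlongrightarrow> y) at_top)"

end

theory Submission
  imports Defs "HOL-Computational_Algebra.Fundamental_Theorem_Algebra"
begin

text \<open>Along trajectories the function
  \<open>V = \<Sum>i. |x_i - xb_i|^2 / (2 \<alpha>_i) + \<Sum>k. |z_k - zb_k|^2 / (2 \<beta>_k)\<close> built from any equilibrium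
  satisfies \<open>V' \<le> - \<Sum>j. (w_j \<bullet> Q w_j) / 2\<close>, where \<open>Q\<close> is the given block matrix and
  \<open>w_j\<close> collects the \<open>j\<close>-th coordinates of the deviations of \<open>y\<close> and \<open>z\<close>. So all equilibria are
  stable and trajectories are bounded.

  Convergence does not need the invariance principle. Barbalat's lemma gives \<open>V' \<longlonglongrightarrow> 0\<close>, hence
  \<open>Q w_j \<longlonglongrightarrow> 0\<close>, and the upper block of this expresses the deviation of \<open>y\<close> by that of \<open>z\<close> up to a vanishing
  error. Therefore \<open>z\<close> is a bounded asymptotic solution of the linear system with matrix
  \<open>-1/2 P\<close>, where \<open>P\<close> is the matrix of the spectral assumption, and this forces \<open>z' \<longlonglongrightarrow> 0\<close>.
  Since \<open>x\<close> is a function of \<open>z\<close> up to a vanishing error, its increments over a fixed time tend to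
  0 too, so \<open>x' \<longlonglongrightarrow> 0\<close>. Thus every limit point of a trajectory is an equilibrium,
  and since that equilibrium is stable the trajectory converges to it.\<close>

subsection \<open>Asymptotics of differentiable functions\<close>

text \<open>The mean value inequality for \<open>v \<tau> - \<tau> *\<^sub>R a\<close>, whose
  derivative \<open>v' \<tau> - a\<close> is small: over the window \<open>v\<close> moves almost
  along a straight line. The three asymptotic lemmas on increments below rest on this.\<close>

lemma increment_approximation:
  fixes v :: "real \<Rightarrow> 'a::real_normed_vector"
  assumes "\<And>\<tau>. \<tau> \<in> {t..t + T} \<Longrightarrow> (v has_vector_derivative v' \<tau>) (at \<tau> within {t..t + T})"
    and "\<And>\<tau>. \<tau> \<in> {t..t + T} \<Longrightarrow> norm (v' \<tau> - a) \<le> \<delta>"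
    and "T \<ge> 0"
  shows "norm (v (t + T) - v t - T *\<^sub>R a) \<le> T * \<delta>"
proof -
  define g where "g = (\<lambda>\<tau>. v \<tau> - \<tau> *\<^sub>R a)"
  have "norm (g (t + T) - g t) \<le> \<delta> * norm (t + T - t)"
  proof (rule differentiable_bound[where S = "{t..t + T}" and f' = "\<lambda>\<tau> h. h *\<^sub>R (v' \<tau> - a)"])
    fix \<tau> assume \<tau>: "\<tau> \<in> {t..t + T}"
    have "(g has_vector_derivative v' \<tau> - a) (at \<tau> within {t..t + T})"
      unfolding g_def using assms(1)[OF \<tau>] by (auto intro!: derivative_eq_intros)
    then show "(g has_derivative (\<lambda>h. h *\<^sub>R (v' \<tau> - a))) (at \<tau> within {t..t + T})"
      by (simp add: has_vector_derivative_def)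
    show "onorm (\<lambda>h. h *\<^sub>R (v' \<tau> - a)) \<le> \<delta>"
      by (rule onorm_le) (use assms(2)[OF \<tau>] in \<open>simp add: mult.commute[of \<delta>] mult_left_mono\<close>)
  qed (use assms in auto)
  then show ?thesis
    using assms(3) by (simp add: g_def algebra_simps)
qed

lemma has_vector_derivative_antimono:
  fixes \<phi> :: "real \<Rightarrow> real"
  assumes "\<And>t. t \<ge> 0 \<Longrightarrow> (\<phi> has_vector_derivative \<phi>' t) (at t within {0..})"
    and "\<And>t. t \<ge> a \<Longrightarrow> \<phi>' t \<le> 0" and "0 \<le> a" "a \<le> b"
  shows "\<phi> b \<le> \<phi> a"
proof (rule DERIV_nonpos_imp_decreasing_open[OF \<open>a \<le> b\<close>])
  fix x assume x: "a < x" "x < b"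
  then have "at x within {0..} = at x"
    using assms(3) by (intro at_within_interior) (auto simp: interior_real_atLeast)
  then show "\<exists>y. DERIV \<phi> x :> y \<and> y \<le> 0"
    using assms(1)[of x] assms(2)[of x] x assms(3)
    by (auto simp: has_real_derivative_iff_has_vector_derivative)
next
  have "continuous_on {0..} \<phi>"
    using assms(1) by (auto intro!: has_vector_derivative_continuous simp: continuous_on_eq_continuous_within)
  then show "continuous_on {a..b} \<phi>"
    by (rule continuous_on_subset) (use assms(3) in auto)
qed

text \<open>Barbalat's lemma, under a hypothesis weaker than convergence of \<open>v\<close>.\<close>

lemma barbalat:
  fixes v :: "real \<Rightarrow> 'a::real_normed_vector"
  assumes der: "\<And>t. t \<ge> 0 \<Longrightarrow> (v has_vector_derivative v' t) (at t within {0..})"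
    and uc: "uniformly_continuous_on {0..} v'"
    and incr: "\<And>T. T > 0 \<Longrightarrow> ((\<lambda>t. v (t + T) - v t) \<longlongrightarrow> 0) at_top"
  shows "(v' \<longlongrightarrow> 0) at_top"
proof (rule tendstoI)
  fix e :: real assume e: "e > 0"
  obtain d where d: "d > 0" "\<And>t \<tau>. t \<ge> 0 \<Longrightarrow> \<tau> \<ge> 0 \<Longrightarrow> dist \<tau> t < d \<Longrightarrow> dist (v' \<tau>) (v' t) < e/2"
    using uc[unfolded uniformly_continuous_on_def, rule_format, of "e/2"] e by auto
  \<comment> \<open>Half of the uniform continuity radius keeps the closed window
    \<open>{t..t + T}\<close> strictly within distance \<open>d\<close> of \<open>t\<close>.\<close>
  define T where "T = d/2"
  have T: "T > 0" using d by (simp add: T_def)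
  have "\<forall>\<^sub>F t in at_top. dist (v (t + T) - v t) 0 < T * (e/2)"
    using incr[OF T] by (rule tendstoD) (use T e in auto)
  moreover have "\<forall>\<^sub>F t::real in at_top. t \<ge> 0" by (rule eventually_ge_at_top)
  ultimately show "\<forall>\<^sub>F t in at_top. dist (v' t) 0 < e"
  proof eventually_elim
    case (elim t)
    have "norm (v (t + T) - v t - T *\<^sub>R v' t) \<le> T * (e/2)"
    proof (rule increment_approximation)
      fix \<tau> assume \<tau>: "\<tau> \<in> {t..t + T}"
      show "(v has_vector_derivative v' \<tau>) (at \<tau> within {t..t + T})"
        by (rule has_vector_derivative_within_subset[OF der]) (use \<tau> elim in auto)
      show "norm (v' \<tau> - v' t) \<le> e/2"
        using d(2)[of t \<tau>] \<tau> elim d(1) by (auto simp: dist_norm T_def)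
    qed (use T in auto)
    moreover have "norm (T *\<^sub>R v' t) \<le> norm (v (t + T) - v t) + norm (v (t + T) - v t - T *\<^sub>R v' t)"
      using norm_triangle_ineq4[of "v (t + T) - v t" "v (t + T) - v t - T *\<^sub>R v' t"] by simp
    moreover have "norm (v (t + T) - v t) < T * (e/2)"
      using elim by simp
    ultimately have "norm (T *\<^sub>R v' t) < T * e" by argo
    then show ?case using T by simp
  qed
qed

lemma barbalat_convergent:
  fixes v :: "real \<Rightarrow> 'a::real_normed_vector"
  assumes "\<And>t. t \<ge> 0 \<Longrightarrow> (v has_vector_derivative v' t) (at t within {0..})"
    and "uniformly_continuous_on {0..} v'" and "(v \<longlongrightarrow> l) at_top"
  shows "(v' \<longlongrightarrow> 0) at_top"
proof (rule barbalat[OF assms(1,2)])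
  fix T :: real
  have "filterlim (\<lambda>t. T + t) at_top at_top"
    by (rule filterlim_tendsto_add_at_top[OF tendsto_const filterlim_ident])
  then have "((\<lambda>t. v (t + T)) \<longlongrightarrow> l) at_top"
    using filterlim_compose[OF assms(3)] by (simp add: add.commute)
  from tendsto_diff[OF this assms(3)] show "((\<lambda>t. v (t + T) - v t) \<longlongrightarrow> 0) at_top" by simp
qed

text \<open>A partial converse of Barbalat's lemma. Here \<open>v\<close> itself may fail to
  converge, which is why \<open>barbalat\<close> is stated with increments.\<close>

lemma increment_tendsto_0:
  fixes v :: "real \<Rightarrow> 'a::real_normed_vector"
  assumes der: "\<And>t. t \<ge> 0 \<Longrightarrow> (v has_vector_derivative v' t) (at t within {0..})"
    and lim: "(v' \<longlongrightarrow> 0) at_top" and T: "T > 0"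
  shows "((\<lambda>t. v (t + T) - v t) \<longlongrightarrow> 0) at_top"
proof (rule tendstoI)
  fix e :: real assume e: "e > 0"
  have "\<forall>\<^sub>F t in at_top. dist (v' t) 0 < e/(2*T)"
    using lim by (rule tendstoD) (use T e in auto)
  then obtain t0 where t0: "\<And>t. t \<ge> t0 \<Longrightarrow> norm (v' t) < e/(2*T)"
    by (auto simp: eventually_at_top_linorder)
  have "norm (v (t + T) - v t) < e" if t: "t \<ge> max 0 t0" for t
  proof -
    have "norm (v (t + T) - v t - T *\<^sub>R 0) \<le> T * (e/(2*T))"
    proof (rule increment_approximation)
      fix \<tau> assume \<tau>: "\<tau> \<in> {t..t + T}"
      show "(v has_vector_derivative v' \<tau>) (at \<tau> within {t..t + T})"
        by (rule has_vector_derivative_within_subset[OF der]) (use \<tau> t in auto)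
      show "norm (v' \<tau> - 0) \<le> e/(2*T)"
        using t0[of \<tau>] \<tau> t by simp
    qed (use T in auto)
    then show ?thesis using e T by simp
  qed
  then show "\<forall>\<^sub>F t in at_top. dist (v (t + T) - v t) 0 < e"
    by (auto simp: eventually_at_top_linorder intro!: exI[of _ "max 0 t0"])
qed

text \<open>If \<open>w\<close> stayed away from 0, then it would be almost constant over long time intervals, and
  \<open>v\<close> would leave every bounded set.\<close>

lemma slowly_varying_tendsto_0:
  fixes v w :: "real \<Rightarrow> 'a::real_normed_vector"
  assumes derv: "\<And>t. t \<ge> 0 \<Longrightarrow> (v has_vector_derivative v' t) (at t within {0..})"
    and derw: "\<And>t. t \<ge> 0 \<Longrightarrow> (w has_vector_derivative w' t) (at t within {0..})"
    and bounded: "bounded (v ` {0..})"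
    and lim: "((\<lambda>t. v' t - w t) \<longlongrightarrow> 0) at_top" "(w' \<longlongrightarrow> 0) at_top"
  shows "(w \<longlongrightarrow> 0) at_top"
proof (rule tendstoI)
  fix e :: real assume e: "e > 0"
  obtain B where B: "B > 0" "\<And>t. t \<ge> 0 \<Longrightarrow> norm (v t) \<le> B"
    using bounded unfolding bounded_pos by auto
  \<comment> \<open>The window length is chosen so that \<open>T * e = 4 * B\<close>. The increment
    of \<open>v\<close> is at most \<open>2 * B\<close> and the approximation error at most
    \<open>T * (e/4) = B\<close>, so \<open>T * norm (w t)\<close> is at most
    \<open>3 * B < T * e\<close>.\<close>
  define T where "T = 4 * B / e"
  have T: "T > 0" and Te: "T * e = 4 * B" using B e by (auto simp: T_def)
  have "\<forall>\<^sub>F t in at_top. dist (v' t - w t) 0 < e/8"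
    using lim(1) by (rule tendstoD) (use e in auto)
  moreover have "\<forall>\<^sub>F t in at_top. dist (w' t) 0 < e/(8*T)"
    using lim(2) by (rule tendstoD) (use e T in auto)
  moreover have "\<forall>\<^sub>F t::real in at_top. t \<ge> 0" by (rule eventually_ge_at_top)
  ultimately have "\<forall>\<^sub>F t in at_top. t \<ge> 0 \<and> norm (v' t - w t) < e/8 \<and> norm (w' t) < e/(8*T)"
    by eventually_elim simp
  then obtain t0 where t0: "\<And>t. t \<ge> t0 \<Longrightarrow> t \<ge> 0 \<and> norm (v' t - w t) < e/8 \<and> norm (w' t) < e/(8*T)"
    by (auto simp: eventually_at_top_linorder)
  have "norm (w t) < e" if t: "t \<ge> t0" for t
  proof -
    have wt: "norm (w \<tau> - w t) \<le> e/8" if \<tau>: "\<tau> \<in> {t..t + T}" for \<tau>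
    proof -
      have "norm (w (t + (\<tau> - t)) - w t - (\<tau> - t) *\<^sub>R 0) \<le> (\<tau> - t) * (e/(8*T))"
      proof (rule increment_approximation)
        fix \<sigma> assume \<sigma>: "\<sigma> \<in> {t..t + (\<tau> - t)}"
        show "(w has_vector_derivative w' \<sigma>) (at \<sigma> within {t..t + (\<tau> - t)})"
          by (rule has_vector_derivative_within_subset[OF derw]) (use \<sigma> t0[OF t] in auto)
        show "norm (w' \<sigma> - 0) \<le> e/(8*T)"
          using t0[of \<sigma>] \<sigma> t by simp
      qed (use \<tau> in auto)
      also have "\<dots> \<le> T * (e/(8*T))"
        using \<tau> T e by (intro mult_right_mono) auto
      finally show ?thesis using T by simp
    qed
    have "norm (v (t + T) - v t - T *\<^sub>R w t) \<le> T * (e/4)"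
    proof (rule increment_approximation)
      fix \<tau> assume \<tau>: "\<tau> \<in> {t..t + T}"
      show "(v has_vector_derivative v' \<tau>) (at \<tau> within {t..t + T})"
        by (rule has_vector_derivative_within_subset[OF derv]) (use \<tau> t0[OF t] in auto)
      \<comment> \<open>One \<open>e/8\<close> is the defect \<open>v' - w\<close>, the other the
        drift of \<open>w\<close> over the window, whose speed is below
        \<open>e/(8*T)\<close>.\<close>
      have "norm (v' \<tau> - w t) \<le> norm (v' \<tau> - w \<tau>) + norm (w \<tau> - w t)"
        using norm_triangle_ineq[of "v' \<tau> - w \<tau>" "w \<tau> - w t"] by simp
      then show "norm (v' \<tau> - w t) \<le> e/4"
        using wt[OF \<tau>] t0[of \<tau>] \<tau> t by simp
    qed (use T in auto)
    moreover have "norm (T *\<^sub>R w t) \<le> norm (v (t + T) - v t) + norm (v (t + T) - v t - T *\<^sub>R w t)"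
      using norm_triangle_ineq4[of "v (t + T) - v t" "v (t + T) - v t - T *\<^sub>R w t"] by simp
    moreover have "norm (v (t + T) - v t) \<le> 2 * B"
      using norm_triangle_ineq4[of "v (t + T)" "v t"] B(2)[of t] B(2)[of "t + T"] t0[OF t] T by simp
    ultimately have "T * norm (w t) \<le> 2 * B + T * (e/4)"
      using T by simp
    also have "\<dots> < T * e" using Te B by simp
    finally show ?thesis using T by simp
  qed
  then show "\<forall>\<^sub>F t in at_top. dist (w t) 0 < e"
    by (auto simp: eventually_at_top_linorder)
qed

text \<open>Gronwall argument: once \<open>\<eta> < a * d\<close>, the product of
  \<open>\<phi> - d\<close> with the integrating factor \<open>exp (a * t)\<close> is nonincreasing,
  so \<open>\<phi>\<close> exceeds \<open>d\<close> by at most an exponentially decaying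
  term.\<close>

lemma differential_inequality_tendsto_0:
  fixes \<phi> \<eta> :: "real \<Rightarrow> real"
  assumes der: "\<And>t. t \<ge> 0 \<Longrightarrow> (\<phi> has_vector_derivative \<phi>' t) (at t within {0..})"
    and "\<And>t. \<phi> t \<ge> 0" and "a > 0"
    and ineq: "\<And>t. t \<ge> 0 \<Longrightarrow> \<phi>' t \<le> - a * \<phi> t + \<eta> t"
    and "(\<eta> \<longlongrightarrow> 0) at_top"
  shows "(\<phi> \<longlongrightarrow> 0) at_top"
proof (rule tendstoI)
  fix e :: real assume e: "e > 0"
  define d where "d = e/2"
  have d: "d > 0" using e by (simp add: d_def)
  have "\<forall>\<^sub>F t in at_top. dist (\<eta> t) 0 < a * d"
    using assms(5) by (rule tendstoD) (use d assms(3) in auto)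
  moreover have "\<forall>\<^sub>F t::real in at_top. t \<ge> 0" by (rule eventually_ge_at_top)
  ultimately have "\<forall>\<^sub>F t in at_top. t \<ge> 0 \<and> \<eta> t < a * d"
    by eventually_elim auto
  then obtain t0 where t0: "\<And>t. t \<ge> t0 \<Longrightarrow> t \<ge> 0 \<and> \<eta> t < a * d"
    by (auto simp: eventually_at_top_linorder)
  define \<psi> where "\<psi> = (\<lambda>t. (\<phi> t - d) * exp (a * t))"
  have \<psi>: "(\<psi> has_vector_derivative (\<phi>' t + a * (\<phi> t - d)) * exp (a * t)) (at t within {0..})"
    if "t \<ge> 0" for t
    using der[OF that] unfolding \<psi>_def has_real_derivative_iff_has_vector_derivative[symmetric]
    by (auto intro!: derivative_eq_intros simp: algebra_simps)
  have bound: "\<psi> t \<le> \<psi> t0" if t: "t \<ge> t0" for t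
  proof (rule has_vector_derivative_antimono[OF \<psi>])
    fix \<tau> assume "\<tau> \<ge> t0"
    then have "\<phi>' \<tau> + a * (\<phi> \<tau> - d) \<le> 0"
      using ineq[of \<tau>] t0[of \<tau>] by (simp add: algebra_simps)
    then show "(\<phi>' \<tau> + a * (\<phi> \<tau> - d)) * exp (a * \<tau>) \<le> 0"
      by (simp add: mult_nonpos_nonneg)
  qed (use t t0 in auto)
  have "filterlim (\<lambda>t. a * t) at_top at_top"
    by (rule filterlim_tendsto_pos_mult_at_top[OF tendsto_const assms(3) filterlim_ident])
  then have "((\<lambda>t. \<psi> t0 * inverse (exp (a * t))) \<longlongrightarrow> \<psi> t0 * 0) at_top"
    by (intro tendsto_intros tendsto_inverse_0_at_top filterlim_compose[OF exp_at_top])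
  then have "\<forall>\<^sub>F t in at_top. dist (\<psi> t0 * inverse (exp (a * t))) 0 < d"
    using d by (intro tendstoD) auto
  moreover have "\<forall>\<^sub>F t in at_top. t \<ge> t0" by (rule eventually_ge_at_top)
  ultimately show "\<forall>\<^sub>F t in at_top. dist (\<phi> t) 0 < e"
  proof eventually_elim
    case (elim t)
    have "\<phi> t - d \<le> \<psi> t0 * inverse (exp (a * t))"
      using bound[OF elim(2)] by (simp add: \<psi>_def[of] field_simps)
    then show ?case using elim(1) assms(2)[of t] by (simp add: d_def)
  qed
qed

lemma antimono_bounded_below_tendsto:
  fixes \<phi> :: "real \<Rightarrow> real"
  assumes "\<And>s t. 0 \<le> s \<Longrightarrow> s \<le> t \<Longrightarrow> \<phi> t \<le> \<phi> s" and "\<And>t. c \<le> \<phi> t"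
  shows "(\<phi> \<longlongrightarrow> Inf (\<phi> ` {0..})) at_top"
proof (rule order_tendstoI)
  have bdd: "bdd_below (\<phi> ` {0..})" using assms(2) by (auto simp: bdd_below_def)
  fix a
  { assume "a < Inf (\<phi> ` {0..})"
    then have "a < \<phi> t" if "t \<ge> 0" for t
      using cInf_lower[OF _ bdd, of "\<phi> t"] that by force
    then show "\<forall>\<^sub>F t in at_top. a < \<phi> t" by (auto simp: eventually_at_top_linorder) }
  { assume "Inf (\<phi> ` {0..}) < a"
    then obtain t0 where "t0 \<ge> 0" "\<phi> t0 < a"
      using cInf_lessD[of "\<phi> ` {0..}" a] by auto
    then have "\<phi> t < a" if "t \<ge> t0" for t
      using assms(1)[of t0 t] that by linarith
    then show "\<forall>\<^sub>F t in at_top. \<phi> t < a" by (auto simp: eventually_at_top_linorder) }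
qed

subsection \<open>Bounded asymptotic solutions of linear systems\<close>

text \<open>This is the vector \<open>p(A) v\<close>, evaluated by Horner's scheme.\<close>

definition matrix_poly_mult :: "complex^'k^'k \<Rightarrow> complex poly \<Rightarrow> complex^'k \<Rightarrow> complex^'k" where
  "matrix_poly_mult A p v = fold_coeffs (\<lambda>a u. a *s v + A *v u) p 0"

lemma matrix_poly_mult_0 [simp]: "matrix_poly_mult A 0 v = 0"
  by (simp add: matrix_poly_mult_def)

lemma matrix_poly_mult_pCons [simp]:
  "matrix_poly_mult A (pCons a p) v = a *s v + A *v matrix_poly_mult A p v"
  by (cases "a = 0 \<and> p = 0") (auto simp: matrix_poly_mult_def)

lemma matrix_poly_mult_add:
  "matrix_poly_mult A (p + q) v = matrix_poly_mult A p v + matrix_poly_mult A q v"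
  by (induction p q rule: poly_induct2)
    (auto simp: matrix_vector_right_distrib vec.scale_left_distrib)

lemma matrix_poly_mult_smult:
  "matrix_poly_mult A (smult c p) v = c *s matrix_poly_mult A p v"
  by (induction p) (auto simp: vec.scale_right_distrib vector_scalar_commute)

lemma matrix_poly_mult_sum:
  "matrix_poly_mult A (\<Sum>i\<in>I. p i) v = (\<Sum>i\<in>I. matrix_poly_mult A (p i) v)"
  by (induction I rule: infinite_finite_induct) (auto simp: matrix_poly_mult_add)

lemma matrix_poly_mult_linear_factor:
  "matrix_poly_mult A ([:- c, 1:] * p) v = A *v matrix_poly_mult A p v - c *s matrix_poly_mult A p v"
proof -
  have "[:- c, 1:] * p = pCons 0 p + smult (- c) p" by simp
  then show ?thesis by (simp only: matrix_poly_mult_add matrix_poly_mult_smult) simp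
qed

text \<open>Since \<open>p(A)\<close> commutes with \<open>A\<close>, it maps asymptotic solutions
  of \<open>w' = A w\<close> to asymptotic solutions.\<close>

lemma matrix_poly_mult_commute:
  "A *v matrix_poly_mult A p v = matrix_poly_mult A p (A *v v)"
  by (induction p) (auto simp: matrix_vector_right_distrib vector_scalar_commute)

lemma bounded_linear_vector_scalar_mult: "bounded_linear (\<lambda>v :: complex^'k. c *s v)"
  by (rule linear_conv_bounded_linear[THEN iffD1])
    (auto intro!: linearI simp: vec_eq_iff algebra_simps)

lemma bounded_linear_matrix_poly_mult: "bounded_linear (matrix_poly_mult A p)"
proof (induction p)
  case 0
  then show ?case by (simp add: matrix_poly_mult_def[abs_def])
next
  case (pCons a p)
  have "bounded_linear (\<lambda>v. a *s v + A *v matrix_poly_mult A p v)"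
    by (intro bounded_linear_add bounded_linear_vector_scalar_mult
        bounded_linear_compose[OF matrix_vector_mul_bounded_linear pCons.IH])
  then show ?case by simp
qed

lemma matrix_poly_mult_diff:
  "matrix_poly_mult A p (v - w) = matrix_poly_mult A p v - matrix_poly_mult A p w"
  by (rule linear_diff[OF bounded_linear.linear[OF bounded_linear_matrix_poly_mult]])

text \<open>More powers of \<open>A\<close> than the dimension of the matrix space are linearly dependent.\<close>

lemma annihilating_polynomial_exists:
  fixes A :: "complex^'k^'k"
  obtains p where "p \<noteq> 0" "\<And>v. matrix_poly_mult A p v = 0"
proof -
  \<comment> \<open>\<open>B i\<close> is the matrix power \<open>A^i\<close>, so
    \<open>B i *v v\<close> is the value of the monomial of degree \<open>i\<close>.\<close>
  define B where "B = (\<lambda>i. ((**) A ^^ i) (mat 1 :: complex^'k^'k))"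
  have B: "B i *v v = matrix_poly_mult A (monom 1 i) v" for i v
    by (induction i) (auto simp: B_def monom_0 monom_Suc simp flip: matrix_vector_mul_assoc)
  have "\<exists>n. B n \<in> span (B ` {..<n})"
  proof (rule ccontr)
    \<comment> \<open>If every power lay outside the span of its predecessors, the first
      \<open>n\<close> powers would be distinct and independent for every \<open>n\<close>, beyond
      the real dimension of the matrix space.\<close>
    assume *: "\<nexists>n. B n \<in> span (B ` {..<n})"
    have "independent (B ` {..<n}) \<and> card (B ` {..<n}) = n" for n
    proof (induction n)
      case (Suc n)
      have "B n \<notin> B ` {..<n}" using * span_base[of "B n" "B ` {..<n}"] by auto
      moreover have "independent (insert (B n) (B ` {..<n}))"
        using Suc * by (intro independent_insertI) auto
      ultimately show ?case using Suc by (simp add: lessThan_Suc)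
    qed (simp add: independent_empty)
    from this[of "Suc DIM(complex^'k^'k)"] show False
      using independent_bound[of "B ` {..<Suc DIM(complex^'k^'k)}"] by linarith
  qed
  then obtain n where n: "B n \<in> span (B ` {..<n})" by blast
  \<comment> \<open>The combinations are indexed by exponents and not by elements of the image of
    \<open>B\<close>, so each coefficient belongs to a definite power.\<close>
  define U where "U = {\<Sum>i<n. c i *\<^sub>R B i | c. True}"
  have "subspace U"
    unfolding subspace_def
  proof (intro conjI ballI allI)
    show "0 \<in> U" unfolding U_def by (auto intro!: exI[of _ "\<lambda>_. 0"])
  next
    fix x y assume "x \<in> U" "y \<in> U"
    then obtain c d where "x = (\<Sum>i<n. c i *\<^sub>R B i)" "y = (\<Sum>i<n. d i *\<^sub>R B i)" by (auto simp: U_def)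
    then have "x + y = (\<Sum>i<n. (c i + d i) *\<^sub>R B i)" by (simp add: scaleR_add_left sum.distrib)
    then show "x + y \<in> U" unfolding U_def by (intro CollectI exI[of _ "\<lambda>i. c i + d i"]) simp
  next
    fix a x assume "x \<in> U"
    then obtain c where "x = (\<Sum>i<n. c i *\<^sub>R B i)" by (auto simp: U_def)
    then have "a *\<^sub>R x = (\<Sum>i<n. (a * c i) *\<^sub>R B i)" by (simp add: scaleR_sum_right)
    then show "a *\<^sub>R x \<in> U" unfolding U_def by (intro CollectI exI[of _ "\<lambda>i. a * c i"]) simp
  qed
  moreover have "B ` {..<n} \<subseteq> U"
  proof
    fix x assume "x \<in> B ` {..<n}"
    then obtain j where j: "j < n" "x = B j" by auto
    then have "x = (\<Sum>i<n. (if i = j then 1 else 0) *\<^sub>R B i)"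
      by (simp add: if_distrib[of "\<lambda>a. a *\<^sub>R _"] sum.delta cong: if_cong)
    then show "x \<in> U" unfolding U_def by (intro CollectI exI[of _ "\<lambda>i. if i = j then 1 else 0"]) simp
  qed
  ultimately have "span (B ` {..<n}) \<subseteq> U" by (rule span_minimal[rotated])
  then obtain c where c: "B n = (\<Sum>i<n. c i *\<^sub>R B i)" using n by (auto simp: U_def)
  \<comment> \<open>The relation \<open>B n = \<Sum>i<n. c i *\<^sub>R B i\<close> read as a monic
    polynomial. The span is taken over the reals, so the \<open>c i\<close> are real and have to be
    embedded.\<close>
  define p where "p = monom 1 n + (\<Sum>i<n. smult (- complex_of_real (c i)) (monom 1 i))"
  have "coeff p n = 1" by (simp add: p_def coeff_sum)
  then have "p \<noteq> 0" by auto
  moreover have "matrix_poly_mult A p v = 0" for v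
  proof -
    have "(\<Sum>i<n. c i *\<^sub>R B i) *v v = (\<Sum>i<n. complex_of_real (c i) *s (B i *v v))"
      by (simp add: vec_eq_iff matrix_vector_mult_def sum_distrib_left sum_distrib_right
          scaleR_conv_of_real[where 'a = complex] mult.assoc) (subst sum.swap, simp)
    then have "B n *v v = (\<Sum>i<n. complex_of_real (c i) *s (B i *v v))"
      using c by simp
    then show ?thesis
      by (simp add: p_def matrix_poly_mult_add matrix_poly_mult_smult matrix_poly_mult_sum
          vec.scale_minus_left sum_negf B del: smult_minus_left)
  qed
  ultimately show ?thesis using that by blast
qed

text \<open>The inner product is the real one, for which multiplication by \<open>\<i>\<close> turns
  every vector into an orthogonal one. So only \<open>Re c\<close> governs the growth of the squared
  norm.\<close>

lemma inner_complex_scalar: "w \<bullet> (c *s w) = Re c * (w \<bullet> w)" for w :: "complex^'k"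
proof -
  have "a \<bullet> (c * a) = Re c * (a \<bullet> a)" for a :: complex
    by (simp add: inner_complex_def algebra_simps)
  then show ?thesis by (simp add: inner_vec_def sum_distrib_left)
qed

text \<open>If \<open>w\<close> is a bounded asymptotic solution of \<open>w' = A w\<close>, then every factor
  \<open>A - c\<close> of an annihilating polynomial can be cancelled except for one factor \<open>A\<close>. A factor with
  \<open>Re c < 0\<close> is removed by exponential decay, a repeated factor \<open>A\<close> by slow variation.\<close>

lemma matrix_poly_mult_cancel:
  fixes A :: "complex^'k^'k" and w :: "real \<Rightarrow> complex^'k"
  assumes spec: "\<And>c v. v \<noteq> 0 \<Longrightarrow> A *v v = c *s v \<Longrightarrow> c = 0 \<or> Re c < 0"
    and der: "\<And>t. t \<ge> 0 \<Longrightarrow> (w has_vector_derivative w' t) (at t within {0..})"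
    and bounded: "bounded (w ` {0..})"
    and lim: "((\<lambda>t. w' t - A *v w t) \<longlongrightarrow> 0) at_top"
    and "p \<noteq> 0" "((\<lambda>t. A *v matrix_poly_mult A p (w t)) \<longlongrightarrow> 0) at_top"
  shows "((\<lambda>t. A *v w t) \<longlongrightarrow> 0) at_top"
  using assms(5,6)
proof (induction "degree p" arbitrary: p)
  case 0
  then obtain a where "p = [:a:]" "a \<noteq> 0" by (metis degree_eq_zeroE pCons_eq_0_iff)
  then have "((\<lambda>t. inverse a *s (A *v (a *s w t))) \<longlongrightarrow> inverse a *s 0) at_top"
    using 0 by (intro bounded_linear.tendsto[OF bounded_linear_vector_scalar_mult]) simp
  then show ?case using \<open>a \<noteq> 0\<close> by (simp add: vector_scalar_commute)
next
  case (Suc n)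
  have "\<not> constant (poly p)" using Suc.hyps(2) by (simp add: constant_degree)
  \<comment> \<open>A root \<open>c\<close> is split off from \<open>p\<close>. With
    \<open>p = (X - c) q\<close> it remains to show that \<open>A q(A) w\<close> vanishes in the
    limit, and the induction hypothesis for \<open>q\<close> finishes.\<close>
  then obtain c where "poly p c = 0" using fundamental_theorem_of_algebra by blast
  then obtain q where q: "p = [:- c, 1:] * q" by (metis dvdE poly_eq_0_iff_dvd)
  with \<open>p \<noteq> 0\<close> have "q \<noteq> 0" by auto
  then have "degree p = Suc (degree q)" unfolding q by (subst degree_mult_eq) auto
  with Suc.hyps(2) have deg: "n = degree q" by simp
  \<comment> \<open>Both \<open>v = q(A) w\<close> and \<open>u = A v\<close> are again asymptotic
    solutions of the same linear system.\<close>
  define v where "v = (\<lambda>t. matrix_poly_mult A q (w t))"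
  define v' where "v' = (\<lambda>t. matrix_poly_mult A q (w' t))"
  have derv: "(v has_vector_derivative v' t) (at t within {0..})" if "t \<ge> 0" for t
    unfolding v_def v'_def
    by (rule bounded_linear.has_vector_derivative[OF bounded_linear_matrix_poly_mult der[OF that]])
  have bv: "bounded (v ` {0..})"
    using bounded_linear_image[OF bounded bounded_linear_matrix_poly_mult, of A q]
    by (simp add: v_def image_image)
  have "((\<lambda>t. matrix_poly_mult A q (w' t - A *v w t)) \<longlongrightarrow> matrix_poly_mult A q 0) at_top"
    by (rule bounded_linear.tendsto[OF bounded_linear_matrix_poly_mult lim])
  then have limv: "((\<lambda>t. v' t - A *v v t) \<longlongrightarrow> 0) at_top"
    by (simp add: v_def v'_def matrix_poly_mult_diff matrix_poly_mult_commute
        linear_0[OF bounded_linear.linear[OF bounded_linear_matrix_poly_mult]])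
  define u where "u = (\<lambda>t. A *v v t)"
  define u' where "u' = (\<lambda>t. A *v v' t)"
  have deru: "(u has_vector_derivative u' t) (at t within {0..})" if "t \<ge> 0" for t
    unfolding u_def u'_def
    by (rule bounded_linear.has_vector_derivative[OF matrix_vector_mul_bounded_linear derv[OF that]])
  have bu: "bounded (u ` {0..})"
    using bounded_linear_image[OF bv matrix_vector_mul_bounded_linear, of A]
    by (simp add: u_def image_image)
  have "((\<lambda>t. A *v (v' t - A *v v t)) \<longlongrightarrow> A *v 0) at_top"
    by (rule bounded_linear.tendsto[OF matrix_vector_mul_bounded_linear limv])
  then have limu: "((\<lambda>t. u' t - A *v u t) \<longlongrightarrow> 0) at_top"
    by (simp add: u_def u'_def matrix_vector_mult_diff_distrib)
  \<comment> \<open>The assumption on \<open>p\<close> now says that \<open>(A - c) u\<close> tends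
    to 0.\<close>
  have factor: "((\<lambda>t. A *v u t - c *s u t) \<longlongrightarrow> 0) at_top"
    using Suc.prems(2)
    by (simp add: q matrix_poly_mult_linear_factor u_def v_def matrix_vector_mult_diff_distrib
        vector_scalar_commute del: mult_pCons_left)
  have "(u \<longlongrightarrow> 0) at_top"
  proof -
    consider "c = 0" | "Re c < 0" | "\<And>x. x \<noteq> 0 \<Longrightarrow> A *v x \<noteq> c *s x" using spec by blast
    then show ?thesis
    proof cases
      case 1
      \<comment> \<open>For \<open>c = 0\<close> this means \<open>A u\<close>, and with it
        \<open>u'\<close>, tends to 0. So \<open>u\<close> varies slowly, while \<open>v\<close> is
        bounded with \<open>v' - u\<close> tending to 0.\<close>
      have "(u' \<longlongrightarrow> 0) at_top"
        using tendsto_add[OF limu factor] 1 by simp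
      then show ?thesis
        using slowly_varying_tendsto_0[OF derv deru bv] limv by (simp add: u_def)
    next
      case 2
      define h where "h = (\<lambda>t. u' t - c *s u t)"
      have h: "(h \<longlongrightarrow> 0) at_top"
        using tendsto_add[OF limu factor] by (simp add: h_def)
      have "((\<lambda>t. u t \<bullet> u t) \<longlongrightarrow> 0) at_top"
      proof (rule differential_inequality_tendsto_0)
        fix t :: real assume t: "t \<ge> 0"
        show "((\<lambda>t. u t \<bullet> u t) has_vector_derivative 2 * (u t \<bullet> u' t)) (at t within {0..})"
          using deru[OF t] unfolding has_vector_derivative_def
          by (auto intro!: derivative_eq_intros simp: inner_commute algebra_simps)
        define a where "a = - Re c"
        have a: "a > 0" using 2 by (simp add: a_def)
        \<comment> \<open>Young's inequality by completing the square: half of the decay rate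
          \<open>2 * a\<close> of the squared norm is spent on absorbing the perturbation
          \<open>h\<close>.\<close>
        have "0 \<le> (sqrt a *\<^sub>R u t - (1 / sqrt a) *\<^sub>R h t) \<bullet> (sqrt a *\<^sub>R u t - (1 / sqrt a) *\<^sub>R h t)"
          by simp
        also have "\<dots> = a * (u t \<bullet> u t) - 2 * (u t \<bullet> h t) + (h t \<bullet> h t) / a"
          using a by (simp add: inner_diff_left inner_diff_right inner_commute field_simps)
        finally have "2 * (u t \<bullet> h t) \<le> a * (u t \<bullet> u t) + (h t \<bullet> h t) / a" by simp
        moreover have "u t \<bullet> u' t = - a * (u t \<bullet> u t) + u t \<bullet> h t"
          by (simp add: h_def inner_diff_right inner_complex_scalar a_def)
        ultimately show "2 * (u t \<bullet> u' t) \<le> - (- Re c) * (u t \<bullet> u t) + (h t \<bullet> h t) / (- Re c)"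
          by (simp add: a_def algebra_simps)
      next
        have "((\<lambda>t. h t \<bullet> h t) \<longlongrightarrow> 0) at_top"
          using tendsto_inner[OF h h] by simp
        then show "((\<lambda>t. (h t \<bullet> h t) / (- Re c)) \<longlongrightarrow> 0) at_top" by (rule tendsto_divide_zero)
      qed (use 2 in auto)
      then have "((\<lambda>t. sqrt (u t \<bullet> u t)) \<longlongrightarrow> sqrt 0) at_top" by (intro tendsto_intros)
      then show ?thesis by (simp add: tendsto_norm_zero_iff flip: norm_eq_sqrt_inner)
    next
      case 3
      \<comment> \<open>Here \<open>c\<close> is not an eigenvalue, so \<open>A - c\<close> is
        injective, hence bounded below in finite dimension.\<close>
      define L where "L = (\<lambda>x. A *v x - c *s x)"
      have blL: "bounded_linear L"
        unfolding L_def
        by (intro bounded_linear_sub matrix_vector_mul_bounded_linear bounded_linear_vector_scalar_mult)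
      then have "linear L" by (simp add: linear_conv_bounded_linear)
      moreover have "inj L"
        using 3 by (subst linear_injective_0[OF \<open>linear L\<close>]) (auto simp: L_def)
      ultimately obtain b where b: "b > 0" "\<And>x. b * norm x \<le> norm (L x)"
        using linear_inj_bounded_below_pos by blast
      show ?thesis
      proof (rule Lim_null_comparison)
        show "\<forall>\<^sub>F t in at_top. norm (u t) \<le> norm (L (u t)) / b"
          using b by (simp add: field_simps)
        have "((\<lambda>t. norm (L (u t)) / b) \<longlongrightarrow> norm (0 :: complex^'k) / b) at_top"
          using factor b by (intro tendsto_intros) (auto simp: L_def)
        then show "((\<lambda>t. norm (L (u t)) / b) \<longlongrightarrow> 0) at_top" by simp
      qed
    qed
  qed
  then show ?case
    using Suc.hyps(1)[OF deg \<open>q \<noteq> 0\<close>] by (simp add: u_def v_def)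
qed

text \<open>For an annihilating \<open>p\<close> the premise of the cancellation lemma is trivial.
  The conclusion concerns only \<open>w'\<close>: an error that tends to 0 without being integrable
  may let \<open>w\<close> drift forever along the kernel of \<open>A\<close>.\<close>

theorem bounded_asymptotic_solution:
  fixes A :: "complex^'k^'k" and w :: "real \<Rightarrow> complex^'k"
  assumes "\<And>c v. v \<noteq> 0 \<Longrightarrow> A *v v = c *s v \<Longrightarrow> c = 0 \<or> Re c < 0"
    and "\<And>t. t \<ge> 0 \<Longrightarrow> (w has_vector_derivative w' t) (at t within {0..})"
    and "bounded (w ` {0..})"
    and "((\<lambda>t. w' t - A *v w t) \<longlongrightarrow> 0) at_top"
  shows "(w' \<longlongrightarrow> 0) at_top"
proof -
  obtain p where "p \<noteq> 0" "\<And>v. matrix_poly_mult A p v = 0"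
    using annihilating_polynomial_exists by blast
  then have "((\<lambda>t. A *v w t) \<longlongrightarrow> 0) at_top"
    using matrix_poly_mult_cancel[OF assms, where p = p] by simp
  from tendsto_add[OF assms(4) this] show ?thesis by simp
qed

section \<open>Transfer to real linear systems\<close>

definition complexify :: "real^'k \<Rightarrow> complex^'k" where
  "complexify v = (\<chi> k. complex_of_real (v $ k))"

lemma complexify_matrix_vector_mult:
  "map_matrix complex_of_real A *v complexify v = complexify (A *v v)"
  by (simp add: vec_eq_iff complexify_def matrix_vector_mult_def map_matrix_def)

lemma bounded_linear_complexify: "bounded_linear complexify"
  by (rule linear_conv_bounded_linear[THEN iffD1])
    (auto intro!: linearI simp: complexify_def vec_eq_iff scaleR_conv_of_real[where 'a = complex])

lemma bounded_asymptotic_solution_real: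
  fixes A :: "real^'k^'k" and w :: "real \<Rightarrow> real^'k"
  assumes spec: "\<And>c. complex_eigenvalue A c \<Longrightarrow> c = 0 \<or> Re c < 0"
    and der: "\<And>t. t \<ge> 0 \<Longrightarrow> (w has_vector_derivative w' t) (at t within {0..})"
    and bounded: "bounded (w ` {0..})"
    and lim: "((\<lambda>t. w' t - A *v w t) \<longlongrightarrow> 0) at_top"
  shows "(w' \<longlongrightarrow> 0) at_top"
proof -
  have "((\<lambda>t. complexify (w' t)) \<longlongrightarrow> 0) at_top"
  proof (rule bounded_asymptotic_solution)
    show "c = 0 \<or> Re c < 0"
      if "v \<noteq> 0" "map_matrix complex_of_real A *v v = c *s v" for c v
      using spec that by (auto simp: complex_eigenvalue_def)
    show "((\<lambda>t. complexify (w t)) has_vector_derivative complexify (w' t)) (at t within {0..})"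
      if "t \<ge> 0" for t
      by (rule bounded_linear.has_vector_derivative[OF bounded_linear_complexify der[OF that]])
    show "bounded ((\<lambda>t. complexify (w t)) ` {0..})"
      using bounded_linear_image[OF bounded bounded_linear_complexify] by (simp add: image_image)
    have "((\<lambda>t. complexify (w' t - A *v w t)) \<longlongrightarrow> complexify 0) at_top"
      by (rule bounded_linear.tendsto[OF bounded_linear_complexify lim])
    then show "((\<lambda>t. complexify (w' t) - map_matrix complex_of_real A *v complexify (w t)) \<longlongrightarrow> 0) at_top"
      by (simp add: complexify_matrix_vector_mult
          linear_diff[OF bounded_linear.linear[OF bounded_linear_complexify]]
          linear_0[OF bounded_linear.linear[OF bounded_linear_complexify]])
  qed
  then have "((\<lambda>t. Re (complexify (w' t) $ k)) \<longlongrightarrow> Re ((0 :: complex^'k) $ k)) at_top" for k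
    by (intro tendsto_intros)
  then show ?thesis
    by (intro vec_tendstoI) (simp add: complexify_def)
qed

subsection \<open>Trajectories and Lyapunov stability\<close>

text \<open>The system is autonomous. This allows stability to be invoked from a late time instead
  of time 0.\<close>

lemma trajectory_shift:
  assumes "trajectory F s" and "a \<ge> 0"
  shows "trajectory F (\<lambda>t. s (t + a))"
  unfolding trajectory_def
proof (intro allI impI)
  fix t :: real assume "t \<ge> 0"
  then have "(s has_vector_derivative F (s (t + a))) (at (t + a) within {0..})"
    using assms by (simp add: trajectory_def)
  \<comment> \<open>The chain rule asks for the derivative within the image of the half-line under
    the shift, a subset of \<open>{0..}\<close> because \<open>a \<ge> 0\<close>.\<close>
  then have "(s has_vector_derivative F (s (t + a))) (at (t + a) within (\<lambda>t. t + a) ` {0..})"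
    by (rule has_vector_derivative_within_subset) (use assms(2) in auto)
  moreover have "((\<lambda>t. t + a) has_vector_derivative 1) (at t within {0..})"
    by (auto intro!: derivative_eq_intros)
  ultimately show "((\<lambda>t. s (t + a)) has_vector_derivative F (s (t + a))) (at t within {0..})"
    using vector_diff_chain_within[of "\<lambda>t. t + a" 1 t "{0..}" s] by (simp add: o_def)
qed

text \<open>A bounded trajectory stays in a compact set. There \<open>F\<close> is bounded, which
  makes \<open>s\<close> Lipschitz, and \<open>G\<close> is uniformly continuous. This supplies the
  uniform continuity that Barbalat's lemma needs.\<close>

lemma trajectory_uniformly_continuous:
  fixes F :: "'s::euclidean_space \<Rightarrow> 's" and G :: "'s \<Rightarrow> 'b::metric_space"
  assumes F: "continuous_on UNIV F" and G: "continuous_on UNIV G"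
    and s: "trajectory F s" and bounded: "bounded (s ` {0..})"
  shows "uniformly_continuous_on {0..} (\<lambda>t. G (s t))"
proof -
  define S where "S = closure (s ` {0..})"
  have S: "compact S" using bounded by (simp add: S_def compact_closure)
  have sS: "s t \<in> S" if "t \<ge> 0" for t
    using that closure_subset[of "s ` {0..}"] by (auto simp: S_def)
  have "compact (F ` S)"
    using S F by (intro compact_continuous_image) (auto intro: continuous_on_subset)
  then obtain B where B: "B > 0" "\<And>x. x \<in> S \<Longrightarrow> norm (F x) \<le> B"
    using compact_imp_bounded bounded_pos by (metis image_eqI)
  have "B-lipschitz_on {0..} s"
  proof (rule lipschitz_onI)
    fix x y :: real assume xy: "x \<in> {0..}" "y \<in> {0..}"
    have "norm (s x - s y) \<le> B * norm (x - y)"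
    proof (rule differentiable_bound[where S = "{0..}" and f' = "\<lambda>t h. h *\<^sub>R F (s t)"])
      fix t :: real assume "t \<in> {0..}"
      then show "(s has_derivative (\<lambda>h. h *\<^sub>R F (s t))) (at t within {0..})"
        using s by (simp add: trajectory_def has_vector_derivative_def)
      show "onorm (\<lambda>h. h *\<^sub>R F (s t)) \<le> B"
        by (rule onorm_le)
          (use B(2)[OF sS] \<open>t \<in> {0..}\<close> in \<open>simp add: mult.commute[of B] mult_left_mono\<close>)
    qed (use xy in auto)
    then show "dist (s x) (s y) \<le> B * dist x y" by (simp add: dist_norm)
  qed (use B in auto)
  then have "uniformly_continuous_on {0..} s" by (rule lipschitz_on_uniformly_continuous)
  moreover have "uniformly_continuous_on (s ` {0..}) G"
  proof -
    have "uniformly_continuous_on S G"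
      by (rule compact_uniformly_continuous[OF continuous_on_subset[OF G subset_UNIV] S])
    moreover have "s ` {0..} \<subseteq> S" using sS by auto
    ultimately show ?thesis unfolding uniformly_continuous_on_def by (meson subsetD)
  qed
  ultimately show ?thesis by (rule uniformly_continuous_on_compose)
qed

text \<open>The quadratic lower bound puts the sublevel set
  \<open>V x < c * \<epsilon>\<^sup>2\<close> inside the ball of radius \<open>\<epsilon>\<close>,
  and a trajectory cannot leave a sublevel set.\<close>

lemma lyapunov_stableI:
  assumes "c > 0" and lower: "\<And>x. c * (dist x e)\<^sup>2 \<le> V x"
    and V: "isCont V e" "V e = 0"
    and antimono: "\<And>s t. trajectory F s \<Longrightarrow> t \<ge> 0 \<Longrightarrow> V (s t) \<le> V (s 0)"
  shows "lyapunov_stable F e"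
  unfolding lyapunov_stable_def
proof (intro allI impI)
  fix \<epsilon> :: real assume \<epsilon>: "\<epsilon> > 0"
  then obtain \<delta> where \<delta>: "\<delta> > 0" "\<And>x. dist x e < \<delta> \<Longrightarrow> dist (V x) (V e) < c * \<epsilon>\<^sup>2"
    using V(1) \<open>c > 0\<close> unfolding continuous_at_eps_delta
    by (metis mult_pos_pos zero_less_power)
  have "dist (s t) e < \<epsilon>" if s: "trajectory F s" "dist (s 0) e < \<delta>" and t: "t \<ge> 0" for s t
  proof -
    have "c * (dist (s t) e)\<^sup>2 \<le> V (s t)" by (rule lower)
    also have "\<dots> \<le> V (s 0)" by (rule antimono[OF s(1) t])
    also have "\<dots> < c * \<epsilon>\<^sup>2" using \<delta>(2)[OF s(2)] V(2) by (simp add: dist_real_def)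
    finally have "(dist (s t) e)\<^sup>2 < \<epsilon>\<^sup>2" using \<open>c > 0\<close> by simp
    then show ?thesis using \<epsilon> by (simp add: power2_less_imp_less)
  qed
  then show "\<exists>\<delta>>0. \<forall>s. trajectory F s \<and> dist (s 0) e < \<delta> \<longrightarrow> (\<forall>t\<ge>0. dist (s t) e < \<epsilon>)"
    using \<delta>(1) by blast
qed

text \<open>A limit point exists by compactness; it is an equilibrium, and its stability turns
  the limit point into a limit.\<close>

lemma trajectory_converges:
  fixes F :: "'s::euclidean_space \<Rightarrow> 's"
  assumes F: "continuous_on UNIV F" and s: "trajectory F s" and bounded: "bounded (s ` {0..})"
    and lim: "((\<lambda>t. F (s t)) \<longlongrightarrow> 0) at_top"
    and stable: "\<And>e. equilibrium F e \<Longrightarrow> lyapunov_stable F e"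
  shows "\<exists>e. equilibrium F e \<and> (s \<longlongrightarrow> e) at_top"
proof -
  have "bounded (range (\<lambda>n. s (real n)))"
    by (rule bounded_subset[OF bounded]) auto
  then obtain e r where r: "strict_mono (r :: nat \<Rightarrow> nat)" and e: "((\<lambda>n. s (real n)) \<circ> r) \<longlonglongrightarrow> e"
    using bounded_imp_convergent_subsequence by blast
  have "filterlim (\<lambda>n. real (r n)) at_top sequentially"
    using filterlim_compose[OF filterlim_real_sequentially filterlim_subseq[OF r]] .
  then have "(\<lambda>n. F (s (real (r n)))) \<longlonglongrightarrow> 0" by (rule filterlim_compose[OF lim])
  moreover have "(\<lambda>n. F (s (real (r n)))) \<longlonglongrightarrow> F e"
    using e F by (intro isCont_tendsto_compose[of e F]) (auto simp: o_def continuous_on_eq_continuous_at)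
  ultimately have eq: "equilibrium F e" using LIMSEQ_unique by (auto simp: equilibrium_def)
  have "(s \<longlongrightarrow> e) at_top"
  proof (rule tendstoI)
    fix \<epsilon> :: real assume "\<epsilon> > 0"
    then obtain \<delta> where \<delta>: "\<delta> > 0"
      "\<And>s t. trajectory F s \<Longrightarrow> dist (s 0) e < \<delta> \<Longrightarrow> t \<ge> 0 \<Longrightarrow> dist (s t) e < \<epsilon>"
      using stable[OF eq] unfolding lyapunov_stable_def by metis
    obtain n where n: "dist (s (real (r n))) e < \<delta>"
      using tendstoD[OF e \<delta>(1)] by (auto simp: eventually_sequentially)
    have "dist (s t) e < \<epsilon>" if "t \<ge> real (r n)" for t
      using \<delta>(2)[OF trajectory_shift[OF s, of "real (r n)"], of "t - real (r n)"] n that by simp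
    then show "\<forall>\<^sub>F t in at_top. dist (s t) e < \<epsilon>" by (auto simp: eventually_at_top_linorder)
  qed
  with eq show ?thesis by blast
qed

subsection \<open>Gradients, matrices and stacked vectors\<close>

lemma gradient_eqI:
  assumes "GDERIV f x :> D"
  shows "gradient f x = D"
  unfolding gradient_def
proof (rule the_equality)
  show "GDERIV f x :> D" by (rule assms)
next
  fix D' assume "GDERIV f x :> D'"
  then have "(\<lambda>h. h \<bullet> D') = (\<lambda>h. h \<bullet> D)"
    using assms has_derivative_unique unfolding gderiv_def by blast
  then show "D' = D" by (metis inner_commute vector_eq_rdot)
qed

text \<open>Riesz representation in coordinates: the derivative is the inner product with the vector
  of its values on the basis.\<close>

lemma GDERIV_gradient:
  fixes f :: "'a::euclidean_space \<Rightarrow> real"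
  assumes "f differentiable (at x)"
  shows "GDERIV f x :> gradient f x"
proof -
  obtain f' where f': "(f has_derivative f') (at x)"
    using assms by (auto simp: differentiable_def)
  then have "f' h = h \<bullet> (\<Sum>b\<in>Basis. f' b *\<^sub>R b)" for h
    using linear_sum[OF has_derivative_linear[OF f'], of "\<lambda>b. (h \<bullet> b) *\<^sub>R b" Basis]
    by (simp add: euclidean_representation inner_sum_right mult.commute
        linear_cmul[OF has_derivative_linear[OF f']])
  then have "f' = (\<lambda>h. h \<bullet> (\<Sum>b\<in>Basis. f' b *\<^sub>R b))" by blast
  with f' have "GDERIV f x :> (\<Sum>b\<in>Basis. f' b *\<^sub>R b)"
    unfolding gderiv_def by metis
  with gradient_eqI[OF this] show ?thesis by simp
qed

lemma gradient_half_square: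
  "gradient (\<lambda>\<xi>. 1 / (2 * a) * (\<xi> \<bullet> \<xi>)) x = (1 / a) *\<^sub>R x"
  \<comment> \<open>For \<open>a = 0\<close> both fractions are 0 by the convention on division, so
    the identity persists.\<close>
  by (rule gradient_eqI, cases "a = 0")
    (auto simp: gderiv_def inner_commute intro!: derivative_eq_intros)

lemma GDERIV_arg_min_eq_0:
  assumes "is_arg_min g (\<lambda>_. True) x" and "GDERIV g x :> D"
  shows "D = 0"
proof -
  have "(\<lambda>h. h \<bullet> D) = (\<lambda>h. 0)"
    by (rule differential_zero_maxmin[of x UNIV g])
      (use assms in \<open>auto simp: gderiv_def is_arg_min_linorder\<close>)
  then have "D \<bullet> D = 0" by metis
  then show ?thesis by simp
qed

section \<open>Positive semidefinite forms\<close>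

text \<open>Nonnegativity of the form at \<open>v - (1 / C) *\<^sub>R (Q *v v)\<close>, one gradient
  step away from \<open>v\<close>, gives the bound. So a vanishing form forces \<open>Q *v v\<close>
  to vanish, even for singular \<open>Q\<close>.\<close>

lemma positive_semidefinite_norm_bound:
  fixes Q :: "real^'n^'n"
  assumes "positive_semidefinite Q"
  obtains C where "C > 0" "\<And>v. (norm (Q *v v))\<^sup>2 \<le> C * (v \<bullet> (Q *v v))"
proof -
  obtain C where C: "C > 0" "\<And>v. norm (Q *v v) \<le> norm v * C"
    using bounded_linear.pos_bounded[OF matrix_vector_mul_bounded_linear[of Q]] by blast
  have "(norm (Q *v v))\<^sup>2 \<le> C * (v \<bullet> (Q *v v))" for v
  proof -
    define g where "g = Q *v v"
    have sym: "v \<bullet> (Q *v g) = g \<bullet> g"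
      using assms dot_lmul_matrix[of v Q g]
      by (simp add: positive_semidefinite_def g_def transpose_matrix_vector[symmetric])
    have "0 \<le> (v - (1 / C) *\<^sub>R g) \<bullet> (Q *v (v - (1 / C) *\<^sub>R g))"
      using assms by (simp add: positive_semidefinite_def)
    also have "\<dots> = v \<bullet> g - 2 / C * (g \<bullet> g) + (1 / C)\<^sup>2 * (g \<bullet> (Q *v g))"
      by (simp add: matrix_vector_mult_diff_distrib matrix_vector_mult_scaleR sym inner_diff_left
          inner_diff_right power2_eq_square right_diff_distrib diff_divide_distrib flip: g_def)
    also have "g \<bullet> (Q *v g) \<le> C * (g \<bullet> g)"
    proof -
      have "g \<bullet> (Q *v g) \<le> norm g * norm (Q *v g)" by (rule norm_cauchy_schwarz)
      also have "\<dots> \<le> norm g * (norm g * C)" by (intro mult_left_mono C) auto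
      finally show ?thesis by (simp add: power2_eq_square mult_ac flip: power2_norm_eq_inner)
    qed
    finally have "0 \<le> v \<bullet> g - 2 / C * (g \<bullet> g) + (1 / C)\<^sup>2 * (C * (g \<bullet> g))"
      by (simp add: mult_left_mono)
    also have "\<dots> = v \<bullet> g - (g \<bullet> g) / C" using C by (simp add: field_simps power2_eq_square)
    finally show ?thesis using C by (simp add: field_simps g_def power2_norm_eq_inner)
  qed
  with C(1) show ?thesis using that by blast
qed

lemma positive_semidefinite_tendsto_0:
  fixes Q :: "real^'n^'n"
  assumes "positive_semidefinite Q" and "((\<lambda>t. w t \<bullet> (Q *v w t)) \<longlongrightarrow> 0) F"
  shows "((\<lambda>t. Q *v w t) \<longlongrightarrow> 0) F"
proof -
  obtain C where C: "C > 0" "\<And>v. (norm (Q *v v))\<^sup>2 \<le> C * (v \<bullet> (Q *v v))"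
    using positive_semidefinite_norm_bound[OF assms(1)] by blast
  show ?thesis
  proof (rule Lim_null_comparison)
    show "\<forall>\<^sub>F t in F. norm (Q *v w t) \<le> sqrt (C * (w t \<bullet> (Q *v w t)))"
      using C(2) by (simp add: real_le_rsqrt)
    have "((\<lambda>t. sqrt (C * (w t \<bullet> (Q *v w t)))) \<longlongrightarrow> sqrt (C * 0)) F"
      by (intro tendsto_intros assms(2))
    then show "((\<lambda>t. sqrt (C * (w t \<bullet> (Q *v w t)))) \<longlongrightarrow> 0) F" by simp
  qed
qed

section \<open>Coordinate slices and stacked vectors\<close>

text \<open>Collects the \<open>j\<close>-th coordinates of all blocks. The Kronecker product with
  an identity acts on each slice as the plain matrix, so the closed loop splits into one matrix
  computation per coordinate.\<close>

definition slice :: "'n \<Rightarrow> ('a ^ 'n) ^ 'm \<Rightarrow> 'a ^ 'm" where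
  "slice j v = (\<chi> i. v $ i $ j)"

definition vec_join :: "'a ^ 'p \<Rightarrow> 'a ^ 'q \<Rightarrow> 'a ^ ('p + 'q)" where
  "vec_join v w = (\<chi> i. case i of Inl p \<Rightarrow> v $ p | Inr q \<Rightarrow> w $ q)"

lemma sum_UNIV_Plus:
  "(\<Sum>i\<in>UNIV. g i) = (\<Sum>p\<in>UNIV. g (Inl p)) + (\<Sum>q\<in>UNIV. g (Inr q))"
  for g :: "'p::finite + 'q::finite \<Rightarrow> 'a::comm_monoid_add"
  by (simp add: UNIV_Plus_UNIV[symmetric] sum.Plus del: UNIV_Plus_UNIV)

lemma block_matrix_mult_vec_join:
  "block_matrix A B C D *v vec_join v w = vec_join (A *v v + B *v w) (C *v v + D *v w)"
  by (simp add: vec_eq_iff block_matrix_def vec_join_def matrix_vector_mult_def sum_UNIV_Plus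
      split: sum.split)

lemma vec_join_Inl: "vec_join v w $ Inl p = v $ p"
  by (simp add: vec_join_def)

lemma inner_vec_join: "vec_join v w \<bullet> vec_join v' w' = v \<bullet> v' + w \<bullet> w'"
  by (simp add: inner_vec_def vec_join_def sum_UNIV_Plus)

lemma diag_mult_component: "(diag c *v v) $ i = c $ i * v $ i"
  for c :: "real^'n"
  by (simp add: diag_def matrix_vector_mult_def if_distrib[of "\<lambda>x. x * _"] cong: if_cong)

lemma matrix_inv_mult_vector:
  assumes "invertible A"
  shows "matrix_inv A *v (A *v v) = (v :: real^'n)"
proof -
  have "matrix_inv A ** A = mat 1"
    using someI_ex[OF assms[unfolded invertible_def]] by (simp add: matrix_inv_def)
  then show ?thesis by (simp add: matrix_vector_mul_assoc)
qed

lemma inner_transpose_mult: "z \<bullet> (transpose R *v y) = y \<bullet> (R *v z)"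
  for R :: "real^'k^'m"
  using dot_lmul_matrix[of y R z] by (simp add: inner_commute)

lemma slice_component [simp]: "slice j v $ i = v $ i $ j"
  by (simp add: slice_def)

lemma slice_diff: "slice j (v - w) = slice j v - slice j w"
  by (simp add: vec_eq_iff)

lemma slice_kron_id_mult: "slice j (kron_id_mult R v) = R *v slice j v"
  by (simp add: vec_eq_iff kron_id_mult_def matrix_vector_mult_def)

lemma kron_id_mult_diff: "kron_id_mult R (v - w) = kron_id_mult R v - kron_id_mult R w"
  by (simp add: kron_id_mult_def vec_eq_iff scaleR_diff_right sum_subtractf)

lemma weighted_inner_slices:
  fixes a b :: "(real^'n)^'m"
  shows "(\<Sum>i\<in>UNIV. c $ i * (a $ i \<bullet> b $ i)) = (\<Sum>j\<in>UNIV. slice j a \<bullet> (diag c *v slice j b))"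
  by (simp add: inner_vec_def diag_mult_component sum_distrib_left mult_ac)
    (rule sum.swap)

lemma inner_slices:
  fixes a b :: "(real^'n)^'m"
  shows "(\<Sum>i\<in>UNIV. a $ i \<bullet> b $ i) = (\<Sum>j\<in>UNIV. slice j a \<bullet> slice j b)"
  by (simp add: inner_vec_def) (rule sum.swap)

lemma bounded_linear_slice: "bounded_linear (slice j :: (real^'n)^'m \<Rightarrow> real^'m)"
  by (rule linear_conv_bounded_linear[THEN iffD1])
    (auto intro!: linearI simp: vec_eq_iff)

lemma tendsto_slices:
  fixes v :: "real \<Rightarrow> (real^'n)^'m"
  assumes "\<And>j. ((\<lambda>t. slice j (v t)) \<longlongrightarrow> 0) F"
  shows "(v \<longlongrightarrow> 0) F"
proof (intro vec_tendstoI)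
  fix i j
  have "((\<lambda>t. slice j (v t) $ i) \<longlongrightarrow> 0 $ i) F" by (intro tendsto_intros assms)
  then show "((\<lambda>t. v t $ i $ j) \<longlongrightarrow> 0 $ i $ j) F" by simp
qed

subsection \<open>The closed loop\<close>

locale optimizer_network =
  fixes f :: "'N::finite \<Rightarrow> real ^ 'n::finite \<Rightarrow> real"
    and \<alpha> \<gamma> m M \<nu> \<rho> :: "real ^ 'N"
    and \<beta> :: "real ^ 'K::finite"
    and RA RC :: "real ^ 'K ^ 'N"
    and ystar :: "real ^ 'n"
  assumes alpha: "\<And>i. \<alpha> $ i > 0" and beta: "\<And>k. \<beta> $ k > 0"
    and strongly_convex: "\<And>i. strongly_convex (m $ i) (f i)"
    and lipschitz: "\<And>i. (M $ i)-lipschitz_on UNIV (gradient (f i))"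
    and passivity: "\<And>i. IF_OFEIP (agent_field (\<alpha> $ i) (\<gamma> $ i) (f i)) (agent_output (\<gamma> $ i))
               (\<lambda>\<xi>. 1 / (2 * \<alpha> $ i) * (\<xi> \<bullet> \<xi>)) (\<nu> $ i) (\<rho> $ i)"
    and kernel_RA: "{v. transpose RA *v v = 0} = {c *\<^sub>R 1 | c. True}"
    and kernel_RC: "{v. transpose RC *v v = 0} = {c *\<^sub>R 1 | c. True}"
    and invertible: "invertible (diag \<rho>)"
    and psd: "positive_semidefinite
           (block_matrix (2 *\<^sub>R diag \<rho>) (RC - RA) (transpose (RC - RA))
              (2 *\<^sub>R (transpose RC ** diag \<nu> ** RC)))"
    and spectrum: "\<And>c. complex_eigenvalue (diag \<beta> ** transpose RA ** matrix_inv (diag \<rho>) ** (RC - RA)) c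
               \<Longrightarrow> c = 0 \<or> Re c > 0"
    and minimizer: "is_arg_min (\<lambda>y. \<Sum>i\<in>UNIV. f i y) (\<lambda>_. True) ystar"
begin

abbreviation "F \<equiv> closed_loop_field \<alpha> \<beta> \<gamma> f RA RC"
abbreviation "H \<equiv> closed_loop_output \<gamma> RC"
abbreviation "U \<equiv> agent_input RC :: ('n, 'N, 'K) state \<Rightarrow> _"

abbreviation "Q \<equiv> block_matrix (2 *\<^sub>R diag \<rho>) (RC - RA) (transpose (RC - RA))
              (2 *\<^sub>R (transpose RC ** diag \<nu> ** RC))"

lemma alpha_beta_nonzero [simp]: "\<alpha> $ i \<noteq> 0" "\<beta> $ k \<noteq> 0"
  using alpha[of i] beta[of k] by auto

text \<open>A zero diagonal entry would put a unit vector into the kernel of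
  \<open>diag \<rho>\<close>.\<close>

lemma rho_nonzero: "\<rho> $ i \<noteq> 0"
proof
  assume "\<rho> $ i = 0"
  then have "diag \<rho> *v axis i 1 = 0"
    by (auto simp: vec_eq_iff diag_mult_component axis_def)
  then have "axis i (1 :: real) = 0"
    using matrix_inv_mult_vector[OF invertible, of "axis i 1"] by simp
  then show False by (simp add: axis_eq_0_iff)
qed

lemma Q_mult: "Q *v vec_join y z =
    vec_join (2 *\<^sub>R (diag \<rho> *v y) + (RC - RA) *v z)
      (transpose (RC - RA) *v y + 2 *\<^sub>R (transpose RC *v (diag \<nu> *v (RC *v z))))"
  by (simp add: block_matrix_mult_vec_join scaleR_matrix_vector_assoc matrix_vector_mul_assoc
      matrix_mul_assoc)

text \<open>The two off-diagonal blocks are transposes of each other and contribute the same cross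
  term, hence the common factor 2.\<close>

lemma Q_quadratic_form: "vec_join y z \<bullet> (Q *v vec_join y z) =
    2 * (y \<bullet> (diag \<rho> *v y) + y \<bullet> ((RC - RA) *v z) + (RC *v z) \<bullet> (diag \<nu> *v (RC *v z)))"
  unfolding Q_mult inner_vec_join inner_add_right inner_scaleR_right inner_transpose_mult
  by (simp add: inner_commute)

lemma closed_loop_output_component:
  "H s $ i = fst s $ i + \<gamma> $ i *\<^sub>R U s $ i"
  by (simp add: closed_loop_output_def agent_output_def)

lemma closed_loop_field_fst:
  "fst (F s) $ i = agent_field (\<alpha> $ i) (\<gamma> $ i) (f i) (fst s $ i) (U s $ i)"
  by (simp add: closed_loop_field_def)

lemma closed_loop_field_snd:
  "snd (F s) $ k = \<beta> $ k *\<^sub>R kron_id_mult (transpose RA) (H s) $ k"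
  by (simp add: closed_loop_field_def)

lemma agent_input_diff: "U s - U e = - kron_id_mult RC (snd s - snd e)"
  by (simp add: agent_input_def kron_id_mult_diff)

section \<open>Equilibria and the minimizer\<close>

lemma strongly_monotone: "m $ i > 0"
  "(gradient (f i) a - gradient (f i) b) \<bullet> (a - b) \<ge> m $ i * (norm (a - b))\<^sup>2"
  using strongly_convex[of i] by (auto simp: strongly_convex_def)

lemma GDERIV_objective:
  "GDERIV (f i) y :> gradient (f i) y"
  using strongly_convex[of i] by (intro GDERIV_gradient) (auto simp: strongly_convex_def)

lemma gradient_sum_ystar: "(\<Sum>i\<in>UNIV. gradient (f i) ystar) = 0"
proof (rule GDERIV_arg_min_eq_0[OF minimizer])
  show "GDERIV (\<lambda>y. \<Sum>i\<in>UNIV. f i y) ystar :> (\<Sum>i\<in>UNIV. gradient (f i) ystar)"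
    using GDERIV_objective unfolding gderiv_def inner_sum_right
    by (intro has_derivative_sum) auto
qed

text \<open>The sum of strongly monotone gradients is strictly monotone, so it has at most one
  zero.\<close>

lemma gradient_sum_eq_0_imp:
  assumes "(\<Sum>i\<in>UNIV. gradient (f i) c) = 0"
  shows "c = ystar"
proof (rule ccontr)
  assume "c \<noteq> ystar"
  then have "0 < (\<Sum>i\<in>UNIV. m $ i * (norm (c - ystar))\<^sup>2)"
    using strongly_monotone(1) by (intro sum_pos) auto
  also have "\<dots> \<le> (\<Sum>i\<in>UNIV. (gradient (f i) c - gradient (f i) ystar) \<bullet> (c - ystar))"
    by (intro sum_mono strongly_monotone(2))
  also have "\<dots> = 0"
    by (simp add: sum_subtractf assms gradient_sum_ystar flip: inner_sum_left)
  finally show False by simp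
qed

text \<open>Resting controllers put each slice of the output into the kernel of
  \<open>transpose RA\<close>, so all outputs agree on some \<open>y\<close>. Resting agents have
  \<open>U e $ i = gradient (f i) y\<close>, and the inputs sum to 0 because the columns of
  \<open>RC\<close> do. Hence \<open>y\<close> is a zero of the gradient sum.\<close>

lemma equilibrium_output:
  assumes "equilibrium F e"
  shows "H e = (\<chi> i. ystar)" and "kron_id_mult (transpose RA) (H e) = 0"
proof -
  have F: "fst (F e) = 0" "snd (F e) = 0" using assms by (auto simp: equilibrium_def)
  have "kron_id_mult (transpose RA) (H e) $ k = 0" for k
    using F(2) closed_loop_field_snd[of e k] beta[of k] by simp
  then show kron: "kron_id_mult (transpose RA) (H e) = 0" by (simp add: vec_eq_iff)
  have "\<exists>c. slice j (H e) = c *\<^sub>R 1" for j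
  proof -
    have "transpose RA *v slice j (H e) = 0"
      unfolding slice_kron_id_mult[symmetric] kron by (simp add: vec_eq_iff)
    then show ?thesis using kernel_RA by blast
  qed
  then obtain c where c: "\<And>j. slice j (H e) = c j *\<^sub>R 1" by metis
  define y where "y = (\<chi> j. c j)"
  have "H e $ i $ j = y $ j" for i j
    using arg_cong[OF c[of j], of "\<lambda>v. v $ i"] by (simp add: y_def)
  then have He: "H e $ i = y" for i by (simp add: vec_eq_iff)
  have "gradient (f i) y = U e $ i" for i
  proof -
    have "agent_output (\<gamma> $ i) (fst e $ i) (U e $ i) = y"
      using He[of i] by (simp add: closed_loop_output_def)
    then have "\<alpha> $ i *\<^sub>R (U e $ i - gradient (f i) y) = 0"
      using F(1) closed_loop_field_fst[of e i] by (simp add: agent_field_def scaleR_diff_right)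
    then show ?thesis using alpha[of i] by simp
  qed
  moreover have "(\<Sum>i\<in>UNIV. U e $ i) = 0"
  proof -
    have "transpose RC *v 1 = 0" using kernel_RC by (metis (mono_tags, lifting) mem_Collect_eq scaleR_one)
    then have "(\<Sum>i\<in>UNIV. RC $ i $ k) = 0" for k
      by (simp add: vec_eq_iff matrix_vector_mult_def transpose_def)
    then have "(\<Sum>k\<in>UNIV. (\<Sum>i\<in>UNIV. RC $ i $ k) *\<^sub>R snd e $ k) = 0" by simp
    then show ?thesis
      by (simp add: agent_input_def kron_id_mult_def sum_negf scaleR_sum_left)
        (subst sum.swap, simp)
  qed
  ultimately have "y = ystar" by (intro gradient_sum_eq_0_imp) simp
  with He show "H e = (\<chi> i. ystar)" by (simp add: vec_eq_iff)
qed

text \<open>The orthogonal complement of the range of \<open>RC\<close> is the kernel of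
  \<open>transpose RC\<close>, that is, the multiples of the all-ones vector. A vector with zero sum
  is orthogonal to these.\<close>

lemma range_RC:
  assumes "(\<Sum>i\<in>UNIV. b $ i) = 0"
  shows "\<exists>z. RC *v z = b"
proof -
  obtain p q where p: "p \<in> span (range ((*v) RC))" and q: "\<And>w. w \<in> span (range ((*v) RC)) \<Longrightarrow> orthogonal q w"
    and b: "b = p + q"
    using orthogonal_subspace_decomp_exists[of "range ((*v) RC)" b] by metis
  have span: "span (range ((*v) RC)) = range ((*v) RC)"
    by (intro span_eq_iff[THEN iffD2] linear_subspace_image) auto
  have "(transpose RC *v q) \<bullet> w = 0" for w
    using q[of "RC *v w"] by (simp add: span orthogonal_def dot_lmul_matrix)
  then have "transpose RC *v q = 0" by (metis inner_eq_zero_iff)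
  then obtain c where c: "q = c *\<^sub>R 1" using kernel_RC by blast
  have "q \<bullet> b = 0" using assms by (simp add: c inner_vec_def flip: sum_distrib_left)
  moreover have "q \<bullet> p = 0" using q[OF p] by (simp add: orthogonal_def)
  ultimately have "q = 0" by (simp add: b inner_add_right)
  with p b show ?thesis by (auto simp: span)
qed

text \<open>The inputs must equal the gradients at \<open>ystar\<close>. These sum to 0, so
  \<open>range_RC\<close> yields a controller state coordinate by coordinate, and \<open>x\<close>
  is then fixed by demanding the output \<open>ystar\<close>.\<close>

lemma equilibrium_exists: "\<exists>e. equilibrium F e"
proof -
  have "\<exists>z. RC *v z = - slice j (\<chi> i. gradient (f i) ystar)" for j
  proof (rule range_RC)
    have "(\<Sum>i\<in>UNIV. gradient (f i) ystar) $ j = 0" by (simp add: gradient_sum_ystar)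
    then show "(\<Sum>i\<in>UNIV. (- slice j (\<chi> i. gradient (f i) ystar)) $ i) = 0"
      by (simp add: sum_negf)
  qed
  then obtain z where z: "\<And>j. RC *v z j = - slice j (\<chi> i. gradient (f i) ystar)" by metis
  define zb :: "(real^'n)^'K" where "zb = (\<chi> k. \<chi> j. z j $ k)"
  have "slice j zb = z j" for j by (simp add: zb_def vec_eq_iff)
  then have "slice j (kron_id_mult RC zb) = - slice j (\<chi> i. gradient (f i) ystar)" for j
    by (simp add: slice_kron_id_mult z)
  then have u: "kron_id_mult RC zb $ i = - gradient (f i) ystar" for i
    by (simp add: vec_eq_iff)
  define e :: "('n, 'N, 'K) state" where
    "e = ((\<chi> i. ystar - \<gamma> $ i *\<^sub>R gradient (f i) ystar), zb)"
  have U: "U e $ i = gradient (f i) ystar" for i by (simp add: agent_input_def e_def u)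
  have H: "H e = (\<chi> i. ystar)"
    by (simp add: vec_eq_iff closed_loop_output_component U) (simp add: e_def)
  have "transpose RA *v (ystar $ j *\<^sub>R 1) = 0" for j using kernel_RA by blast
  moreover have "slice j (\<chi> i. ystar) = ystar $ j *\<^sub>R (1 :: real^'N)" for j
    by (simp add: vec_eq_iff)
  ultimately have "slice j (kron_id_mult (transpose RA) (H e)) = 0" for j
    by (simp only: slice_kron_id_mult H)
  then have "kron_id_mult (transpose RA) (H e) = 0" by (simp add: vec_eq_iff)
  then have "snd (F e) = 0" by (simp add: vec_eq_iff[of "snd (F e)"] closed_loop_field_snd)
  moreover have "fst (F e) $ i = 0" for i
    unfolding closed_loop_field_fst agent_field_def U
    using H closed_loop_output_component[of e i] by (simp add: agent_output_def U)
  then have "fst (F e) = 0" by (simp add: vec_eq_iff[of "fst (F e)"])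
  ultimately have "equilibrium F e" by (simp add: equilibrium_def prod_eq_iff)
  then show ?thesis ..
qed

section \<open>The Lyapunov function and its dissipation\<close>

definition V :: "('n, 'N, 'K) state \<Rightarrow> ('n, 'N, 'K) state \<Rightarrow> real" where
  "V e s = (\<Sum>i\<in>UNIV. 1 / (2 * \<alpha> $ i) * ((fst s $ i - fst e $ i) \<bullet> (fst s $ i - fst e $ i)))
         + (\<Sum>k\<in>UNIV. 1 / (2 * \<beta> $ k) * ((snd s $ k - snd e $ k) \<bullet> (snd s $ k - snd e $ k)))"

text \<open>The derivative of \<open>V e\<close> along the vector field, as a function of the state,
  so that its continuity can be used.\<close>

definition DV :: "('n, 'N, 'K) state \<Rightarrow> ('n, 'N, 'K) state \<Rightarrow> real" where
  "DV e s = (\<Sum>i\<in>UNIV. 1 / \<alpha> $ i * ((fst s $ i - fst e $ i) \<bullet> fst (F s) $ i))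
          + (\<Sum>k\<in>UNIV. 1 / \<beta> $ k * ((snd s $ k - snd e $ k) \<bullet> snd (F s) $ k))"

definition deviation :: "'n \<Rightarrow> ('n, 'N, 'K) state \<Rightarrow> ('n, 'N, 'K) state \<Rightarrow> real ^ ('N + 'K)" where
  "deviation j e s = vec_join (slice j (H s - H e)) (slice j (snd s - snd e))"

text \<open>Passivity bounds the agent terms, and the integrators contribute exactly the supplied
  power. With \<open>u = - RC z\<close> in each slice, the two supply terms combine to
  \<open>- y \<bullet> ((RC - RA) *v z)\<close> and the input penalty becomes the form of
  \<open>L_\<nu>\<close>. Together this is minus half the form of \<open>Q\<close>.\<close>

lemma DV_le:
  assumes "equilibrium F e"
  shows "DV e s \<le> - (\<Sum>j\<in>UNIV. deviation j e s \<bullet> (Q *v deviation j e s)) / 2"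
proof -
  define y where "y = H s - H e"
  define z where "z = snd s - snd e"
  define u where "u = U s - U e"
  have u: "u = - kron_id_mult RC z" by (simp add: u_def z_def agent_input_diff)
  have agent: "1 / \<alpha> $ i * ((fst s $ i - fst e $ i) \<bullet> fst (F s) $ i)
      \<le> y $ i \<bullet> u $ i - \<nu> $ i * (u $ i \<bullet> u $ i) - \<rho> $ i * (y $ i \<bullet> y $ i)" for i
  proof -
    have "agent_field (\<alpha> $ i) (\<gamma> $ i) (f i) (fst e $ i) (U e $ i) = 0"
      using assms closed_loop_field_fst[of e i] by (simp add: equilibrium_def)
    then show ?thesis
      using passivity[of i] unfolding IF_OFEIP_def gradient_half_square
      by (auto simp: closed_loop_field_fst y_def u_def closed_loop_output_def)
  qed
  \<comment> \<open>At an equilibrium \<open>transpose RA\<close> annihilates the output, so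
    \<open>H s\<close> may be replaced by its deviation.\<close>
  have controller: "1 / \<beta> $ k * ((snd s $ k - snd e $ k) \<bullet> snd (F s) $ k)
      = z $ k \<bullet> kron_id_mult (transpose RA) y $ k" for k
    using beta[of k]
    by (simp add: closed_loop_field_snd z_def y_def kron_id_mult_diff equilibrium_output(2)[OF assms])
  have "DV e s \<le> (\<Sum>i\<in>UNIV. y $ i \<bullet> u $ i - \<nu> $ i * (u $ i \<bullet> u $ i) - \<rho> $ i * (y $ i \<bullet> y $ i))
      + (\<Sum>k\<in>UNIV. z $ k \<bullet> kron_id_mult (transpose RA) y $ k)"
    unfolding DV_def controller by (intro add_right_mono sum_mono agent)
  also have "\<dots> = (\<Sum>j\<in>UNIV. slice j y \<bullet> slice j u - slice j u \<bullet> (diag \<nu> *v slice j u)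
      - slice j y \<bullet> (diag \<rho> *v slice j y) + slice j z \<bullet> (transpose RA *v slice j y))"
    by (simp add: sum_subtractf sum.distrib inner_slices weighted_inner_slices slice_kron_id_mult)
  also have "\<dots> = (\<Sum>j\<in>UNIV. - (deviation j e s \<bullet> (Q *v deviation j e s)) / 2)"
  proof (rule sum.cong[OF refl])
    fix j
    have uj: "slice j u = - (RC *v slice j z)"
      using slice_kron_id_mult[of j RC z] by (simp add: u vec_eq_iff)
    have "slice j z \<bullet> (transpose RA *v slice j y) = slice j y \<bullet> (RA *v slice j z)"
      by (rule inner_transpose_mult)
    moreover have "diag \<nu> *v (- (RC *v slice j z)) = - (diag \<nu> *v (RC *v slice j z))"
      by (simp add: vec_eq_iff diag_mult_component)
    ultimately show "slice j y \<bullet> slice j u - slice j u \<bullet> (diag \<nu> *v slice j u)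
      - slice j y \<bullet> (diag \<rho> *v slice j y) + slice j z \<bullet> (transpose RA *v slice j y)
      = - (deviation j e s \<bullet> (Q *v deviation j e s)) / 2"
      unfolding deviation_def Q_quadratic_form y_def[symmetric] z_def[symmetric] uj
      by (simp add: matrix_vector_mult_diff_rdistrib inner_diff_right)
  qed
  also have "\<dots> = - (\<Sum>j\<in>UNIV. deviation j e s \<bullet> (Q *v deviation j e s)) / 2"
    by (simp add: sum_negf sum_divide_distrib)
  finally show ?thesis .
qed

lemma quadratic_form_nonneg: "0 \<le> v \<bullet> (Q *v v)"
  using psd by (simp add: positive_semidefinite_def)

lemma DV_nonpos:
  assumes "equilibrium F e"
  shows "DV e s \<le> 0"
proof -
  have "0 \<le> (\<Sum>j\<in>UNIV. deviation j e s \<bullet> (Q *v deviation j e s))"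
    by (intro sum_nonneg quadratic_form_nonneg)
  with DV_le[OF assms, of s] show ?thesis by simp
qed

lemma V_nonneg: "0 \<le> V e s"
  unfolding V_def using alpha beta
  by (intro add_nonneg_nonneg sum_nonneg mult_nonneg_nonneg) (auto simp: less_imp_le)

text \<open>The smallest weight in \<open>V\<close> works for all \<open>e\<close> and
  \<open>s\<close> at once, since the squared distance is the sum of the squared block
  distances.\<close>

lemma V_lower_bound: obtains c where "c > 0" "\<And>e s. c * (dist s e)\<^sup>2 \<le> V e s"
proof -
  define c where "c = Min (range (\<lambda>i. 1 / (2 * \<alpha> $ i)) \<union> range (\<lambda>k. 1 / (2 * \<beta> $ k)))"
  have "c > 0" unfolding c_def using alpha beta by (subst Min_gr_iff) auto
  moreover have "c * (dist s e)\<^sup>2 \<le> V e s" for e s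
  proof -
    have "(dist s e)\<^sup>2 = (\<Sum>i\<in>UNIV. (fst s $ i - fst e $ i) \<bullet> (fst s $ i - fst e $ i))
        + (\<Sum>k\<in>UNIV. (snd s $ k - snd e $ k) \<bullet> (snd s $ k - snd e $ k))"
      by (simp add: dist_norm power2_norm_eq_inner inner_prod_def inner_vec_def[of "fst s - fst e"]
          inner_vec_def[of "snd s - snd e"])
    moreover have "c \<le> 1 / (2 * \<alpha> $ i)" "c \<le> 1 / (2 * \<beta> $ k)" for i k
      unfolding c_def by (auto intro!: Min_le)
    ultimately show ?thesis
      by (simp only: V_def distrib_left sum_distrib_left)
        (intro add_mono sum_mono mult_right_mono inner_ge_zero)
  qed
  ultimately show ?thesis using that by blast
qed

lemma continuous_field: "continuous_on UNIV F"
proof -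
  have out: "continuous_on UNIV (\<lambda>s. agent_output (\<gamma> $ i) (fst s $ i) (U s $ i))" for i
    unfolding agent_output_def agent_input_def kron_id_mult_def
    by (auto intro!: continuous_intros)
  have grad: "continuous_on UNIV (gradient (f i))" for i
    by (rule lipschitz_on_continuous_on[OF lipschitz])
  have "continuous_on UNIV (\<lambda>s. gradient (f i) (agent_output (\<gamma> $ i) (fst s $ i) (U s $ i)))" for i
    by (rule continuous_on_compose2[OF grad out]) auto
  moreover have "continuous_on UNIV U"
    unfolding agent_input_def kron_id_mult_def by (auto intro!: continuous_intros)
  ultimately show ?thesis
    unfolding closed_loop_field_def agent_field_def kron_id_mult_def closed_loop_output_def
    using out by (auto intro!: continuous_intros)
qed

lemma continuous_output: "continuous_on UNIV H"
  unfolding closed_loop_output_def agent_output_def agent_input_def kron_id_mult_def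
  by (auto intro!: continuous_intros)

lemma continuous_V: "continuous_on UNIV (V e)"
  unfolding V_def by (auto intro!: continuous_intros)

lemma continuous_DV: "continuous_on UNIV (DV e)"
  unfolding DV_def
  by (auto intro!: continuous_intros continuous_on_compose2[OF continuous_on_fst[OF continuous_on_id]]
      continuous_field)

lemma has_vector_derivative_V:
  assumes "trajectory F s" and "t \<ge> 0"
  shows "((\<lambda>t. V e (s t)) has_vector_derivative DV e (s t)) (at t within {0..})"
proof -
  have s: "(s has_vector_derivative F (s t)) (at t within {0..})"
    using assms by (simp add: trajectory_def)
  have x: "((\<lambda>t. fst (s t) $ i) has_vector_derivative fst (F (s t)) $ i) (at t within {0..})" for i
    by (intro bounded_linear.has_vector_derivative[OF bounded_linear_vec_nth]
        bounded_linear.has_vector_derivative[OF bounded_linear_fst] s)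
  have z: "((\<lambda>t. snd (s t) $ k) has_vector_derivative snd (F (s t)) $ k) (at t within {0..})" for k
    by (intro bounded_linear.has_vector_derivative[OF bounded_linear_vec_nth]
        bounded_linear.has_vector_derivative[OF bounded_linear_snd] s)
  have square: "((\<lambda>t. 1 / (2 * c) * ((x t - a) \<bullet> (x t - a))) has_vector_derivative
      1 / c * ((x t - a) \<bullet> x')) (at t within {0..})"
    if "c \<noteq> 0" "(x has_vector_derivative x') (at t within {0..})" for x :: "real \<Rightarrow> real^'n" and x' a c
    using that unfolding has_vector_derivative_def
    by (auto intro!: derivative_eq_intros simp: inner_commute field_simps)
  show ?thesis
    unfolding V_def DV_def
    by (intro has_vector_derivative_add has_vector_derivative_sum square x z alpha_beta_nonzero)
qed

lemma V_antimono:
  assumes "equilibrium F e" "trajectory F s" "0 \<le> a" "a \<le> b"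
  shows "V e (s b) \<le> V e (s a)"
  by (rule has_vector_derivative_antimono[OF has_vector_derivative_V[OF assms(2)]
        DV_nonpos[OF assms(1)] assms(3,4)])

section \<open>Stability of equilibria and boundedness of trajectories\<close>

lemma equilibrium_stable:
  assumes "equilibrium F e"
  shows "lyapunov_stable F e"
proof -
  obtain c where c: "c > 0" "\<And>e s. c * (dist s e)\<^sup>2 \<le> V e s" using V_lower_bound by blast
  show ?thesis
  proof (rule lyapunov_stableI[OF c(1) c(2)])
    show "isCont (V e) e"
      using continuous_on_interior[OF continuous_V] by simp
    show "V e e = 0" by (simp add: V_def)
  qed (use V_antimono[OF assms] in auto)
qed

lemma trajectory_bounded:
  assumes "trajectory F s"
  shows "bounded (s ` {0..})"
proof -
  obtain e where e: "equilibrium F e" using equilibrium_exists by blast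
  obtain c where c: "c > 0" "\<And>e s. c * (dist s e)\<^sup>2 \<le> V e s" using V_lower_bound by blast
  have "dist e (s t) \<le> sqrt (V e (s 0) / c)" if "t \<ge> 0" for t
  proof -
    have "c * (dist (s t) e)\<^sup>2 \<le> V e (s 0)"
      using c(2)[of "s t" e] V_antimono[OF e assms order_refl that] by linarith
    then show ?thesis using c(1) by (intro real_le_rsqrt) (simp add: field_simps dist_commute)
  qed
  then show ?thesis unfolding bounded_def by blast
qed

text \<open>On a trajectory along which the dissipation vanishes, the controller states satisfy
  \<open>z' = -1/2 P z\<close>.\<close>

abbreviation "P \<equiv> diag \<beta> ** transpose RA ** matrix_inv (diag \<rho>) ** (RC - RA)"

lemma limit_spectrum:
  assumes "complex_eigenvalue ((- 1 / 2) *\<^sub>R P) c"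
  shows "c = 0 \<or> Re c < 0"
proof -
  obtain v where v: "v \<noteq> 0" "map_matrix complex_of_real ((- 1 / 2) *\<^sub>R P) *v v = c *s v"
    using assms by (auto simp: complex_eigenvalue_def)
  \<comment> \<open>An eigenvalue \<open>c\<close> of \<open>-1/2 P\<close> gives the eigenvalue
    \<open>-2 * c\<close> of \<open>P\<close>, which reverses the sign of the real part.\<close>
  have "map_matrix complex_of_real P *v v
      = (-2) *s (map_matrix complex_of_real ((- 1 / 2) *\<^sub>R P) *v v)"
    by (simp add: vec_eq_iff matrix_vector_mult_def map_matrix_def sum_distrib_left sum_negf)
  also have "\<dots> = (-2 * c) *s v" by (simp only: v vector_smult_assoc)
  finally have "complex_eigenvalue P (-2 * c)" using v(1) by (auto simp: complex_eigenvalue_def)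
  from spectrum[OF this] show ?thesis by auto
qed

section \<open>Vanishing of the vector field along trajectories\<close>

lemma field_tendsto_0:
  assumes s: "trajectory F s"
  shows "((\<lambda>t. F (s t)) \<longlongrightarrow> 0) at_top"
proof -
  obtain e where e: "equilibrium F e" using equilibrium_exists by blast
  note der = s[unfolded trajectory_def, rule_format]
  note uc = trajectory_uniformly_continuous[OF continuous_field _ s trajectory_bounded[OF s]]
  \<comment> \<open>\<open>V e\<close> is nonincreasing and nonnegative along the trajectory, so it
    converges and its derivative vanishes in the limit.\<close>
  have DV: "((\<lambda>t. DV e (s t)) \<longlongrightarrow> 0) at_top"
  proof (rule barbalat_convergent[OF has_vector_derivative_V[OF s] uc[OF continuous_DV]])
    show "((\<lambda>t. V e (s t)) \<longlongrightarrow> Inf ((\<lambda>t. V e (s t)) ` {0..})) at_top"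
      using V_antimono[OF e s] V_nonneg by (rule antimono_bounded_below_tendsto)
  qed
  have quad: "((\<lambda>t. deviation j e (s t) \<bullet> (Q *v deviation j e (s t))) \<longlongrightarrow> 0) at_top" for j
  proof (rule tendsto_sandwich[OF _ _ tendsto_const])
    show "\<forall>\<^sub>F t in at_top. 0 \<le> deviation j e (s t) \<bullet> (Q *v deviation j e (s t))"
      by (simp add: quadratic_form_nonneg)
    \<comment> \<open>A single term of a sum of nonnegative forms is at most the whole sum.\<close>
    have "deviation j e (s t) \<bullet> (Q *v deviation j e (s t)) \<le> -2 * DV e (s t)" for t
      using member_le_sum[of j UNIV "\<lambda>j. deviation j e (s t) \<bullet> (Q *v deviation j e (s t))"]
        DV_le[OF e, of "s t"] by (simp add: quadratic_form_nonneg)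
    then show "\<forall>\<^sub>F t in at_top. deviation j e (s t) \<bullet> (Q *v deviation j e (s t)) \<le> -2 * DV e (s t)"
      by simp
    show "((\<lambda>t. -2 * DV e (s t)) \<longlongrightarrow> 0) at_top"
      using tendsto_mult[OF tendsto_const DV, of "-2"] by simp
  qed
  define Y where "Y = (\<lambda>j t. slice j (H (s t) - H e))"
  define Z where "Z = (\<lambda>j t. slice j (snd (s t) - snd e))"
  \<comment> \<open>The upper block of \<open>Q\<close> applied to the deviation: the error in the
    limiting relation between outputs and controller states.\<close>
  define q where "q = (\<lambda>j t. 2 *\<^sub>R (diag \<rho> *v Y j t) + (RC - RA) *v Z j t)"
  have q: "(q j \<longlongrightarrow> 0) at_top" for j
  proof (rule vec_tendstoI)
    fix i
    show "((\<lambda>t. q j t $ i) \<longlongrightarrow> 0 $ i) at_top"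
      using tendsto_vec_nth[OF positive_semidefinite_tendsto_0[OF psd quad[of j]], of "Inl i"]
      by (simp add: deviation_def Q_mult q_def Y_def Z_def vec_join_Inl)
  qed
  have Zlim: "((\<lambda>t. slice j (snd (F (s t)))) \<longlongrightarrow> 0) at_top" for j
  proof (rule bounded_asymptotic_solution_real[OF limit_spectrum])
    show "(Z j has_vector_derivative slice j (snd (F (s t)))) (at t within {0..})" if "t \<ge> 0" for t
    proof -
      have "((\<lambda>t. snd (s t) - snd e) has_vector_derivative snd (F (s t)) - 0) (at t within {0..})"
        by (intro has_vector_derivative_diff has_vector_derivative_const
            bounded_linear.has_vector_derivative[OF bounded_linear_snd] der that)
      from bounded_linear.has_vector_derivative[OF bounded_linear_slice this]
      show ?thesis by (simp add: Z_def)
    qed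
    have "bounded ((\<lambda>x. snd x - snd e) ` s ` {0..})"
      using bounded_translation_minus[OF bounded_snd[OF trajectory_bounded[OF s]], of "snd e"]
      by (simp add: image_image)
    from bounded_linear_image[OF this bounded_linear_slice, of j]
    show "bounded (Z j ` {0..})" by (simp add: Z_def image_image)
    \<comment> \<open>Solving \<open>q\<close> for the output deviation by inverting
      \<open>diag \<rho>\<close> and inserting it into the controller equation leaves
      \<open>-1/2 P Z\<close> plus a linear image of \<open>q\<close>.\<close>
    have "slice j (snd (F (s t))) - ((- 1 / 2) *\<^sub>R P) *v Z j t
        = (1 / 2) *\<^sub>R ((diag \<beta> ** transpose RA ** matrix_inv (diag \<rho>)) *v q j t)" for t
    proof -
      have "slice j (snd (F (s t))) = diag \<beta> *v slice j (kron_id_mult (transpose RA) (H (s t)))"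
        by (simp add: vec_eq_iff diag_mult_component closed_loop_field_snd)
      also have "kron_id_mult (transpose RA) (H (s t)) = kron_id_mult (transpose RA) (H (s t) - H e)"
        by (simp add: kron_id_mult_diff equilibrium_output(2)[OF e])
      finally have "slice j (snd (F (s t))) = diag \<beta> *v (transpose RA *v Y j t)"
        by (simp add: slice_kron_id_mult Y_def)
      also have "Y j t = matrix_inv (diag \<rho>) *v (diag \<rho> *v Y j t)"
        by (simp add: matrix_inv_mult_vector[OF invertible])
      also have "diag \<rho> *v Y j t = (1 / 2) *\<^sub>R (q j t - (RC - RA) *v Z j t)"
        by (simp add: q_def)
      finally have *: "slice j (snd (F (s t))) = diag \<beta> *v (transpose RA *v (matrix_inv (diag \<rho>) *v
          ((1 / 2) *\<^sub>R (q j t - (RC - RA) *v Z j t))))" .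
      show ?thesis
        unfolding * scaleR_matrix_vector_assoc[symmetric] matrix_vector_mul_assoc[symmetric]
        by (simp add: matrix_vector_mult_diff_distrib matrix_vector_mult_scaleR scaleR_diff_right
            del: transpose_matrix_vector)
    qed
    moreover have "((\<lambda>t. (1 / 2) *\<^sub>R ((diag \<beta> ** transpose RA ** matrix_inv (diag \<rho>)) *v q j t))
        \<longlongrightarrow> (1 / 2) *\<^sub>R ((diag \<beta> ** transpose RA ** matrix_inv (diag \<rho>)) *v 0)) at_top"
      by (intro tendsto_intros bounded_linear.tendsto[OF matrix_vector_mul_bounded_linear q])
    ultimately show "((\<lambda>t. slice j (snd (F (s t))) - ((- 1 / 2) *\<^sub>R P) *v Z j t) \<longlongrightarrow> 0) at_top"
      by simp
  qed
  then have snd_lim: "((\<lambda>t. snd (F (s t))) \<longlongrightarrow> 0) at_top" by (rule tendsto_slices)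
  have fst_lim: "((\<lambda>t. fst (F (s t))) \<longlongrightarrow> 0) at_top"
  proof (rule barbalat)
    show "((\<lambda>t. fst (s t)) has_vector_derivative fst (F (s t))) (at t within {0..})" if "t \<ge> 0" for t
      by (intro bounded_linear.has_vector_derivative[OF bounded_linear_fst] der that)
    show "uniformly_continuous_on {0..} (\<lambda>t. fst (F (s t)))"
      by (rule uc[OF continuous_on_fst[OF continuous_field]])
  next
    fix T :: real assume T: "T > 0"
    have "((\<lambda>t. snd (s (t + T)) - snd (s t)) \<longlongrightarrow> 0) at_top"
      by (rule increment_tendsto_0[OF _ snd_lim T])
        (intro bounded_linear.has_vector_derivative[OF bounded_linear_snd] der)
    from bounded_linear.tendsto[OF bounded_linear_slice this]
    have dZ: "((\<lambda>t. Z j (t + T) - Z j t) \<longlongrightarrow> 0) at_top" for j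
      by (simp add: Z_def slice_diff linear_0[OF bounded_linear.linear[OF bounded_linear_slice]])
    have dRZ: "((\<lambda>t. (R *v (Z j (t + T) - Z j t)) $ i) \<longlongrightarrow> 0) at_top" for R :: "real^'K^'N" and j i
      using tendsto_vec_nth[OF bounded_linear.tendsto[OF matrix_vector_mul_bounded_linear[of R] dZ[of j]], of i]
      by simp
    have shift: "filterlim (\<lambda>t. t + T) at_top at_top"
      using filterlim_tendsto_add_at_top[OF tendsto_const[of T] filterlim_ident]
      by (simp only: add.commute)
    have dq: "((\<lambda>t. (q j (t + T) - q j t) $ i) \<longlongrightarrow> 0) at_top" for j i
      using tendsto_vec_nth[OF tendsto_diff[OF filterlim_compose[OF q[of j] shift] q[of j]], of i]
      by simp
    show "((\<lambda>t. fst (s (t + T)) - fst (s t)) \<longlongrightarrow> 0) at_top"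
    proof (intro vec_tendstoI)
      fix i j
      \<comment> \<open>The state \<open>x\<close> is the output minus \<open>\<gamma>\<close> times
        the input, and the output deviation is recovered from \<open>q\<close> and \<open>Z\<close>
        by dividing by \<open>2 * \<rho> $ i\<close>. So increments of \<open>x\<close> are
        combinations of those of \<open>q\<close> and \<open>Z\<close>, which vanish in the
        limit.\<close>
      have "(fst (s (t + T)) - fst (s t)) $ i $ j
          = ((q j (t + T) - q j t) $ i - ((RC - RA) *v (Z j (t + T) - Z j t)) $ i) / (2 * \<rho> $ i)
            + \<gamma> $ i * (RC *v (Z j (t + T) - Z j t)) $ i" for t
      proof -
        have x: "fst (s t) $ i $ j = H (s t) $ i $ j + \<gamma> $ i * (RC *v slice j (snd (s t))) $ i" for t
          using arg_cong[OF slice_kron_id_mult[of j RC "snd (s t)"], of "\<lambda>v. v $ i"]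
          by (simp add: closed_loop_output_component agent_input_def)
        have "2 * \<rho> $ i * (H (s (t + T)) $ i $ j - H (s t) $ i $ j)
            = (q j (t + T) - q j t) $ i - ((RC - RA) *v (Z j (t + T) - Z j t)) $ i"
          by (simp add: q_def Y_def diag_mult_component matrix_vector_mult_diff_distrib algebra_simps)
        then have h: "H (s (t + T)) $ i $ j - H (s t) $ i $ j
            = ((q j (t + T) - q j t) $ i - ((RC - RA) *v (Z j (t + T) - Z j t)) $ i) / (2 * \<rho> $ i)"
          using rho_nonzero[of i] by (simp add: field_simps)
        have r: "(RC *v slice j (snd (s (t + T)))) $ i - (RC *v slice j (snd (s t))) $ i
            = (RC *v (Z j (t + T) - Z j t)) $ i"
          by (simp add: Z_def slice_diff matrix_vector_mult_diff_distrib)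
        have "(fst (s (t + T)) - fst (s t)) $ i $ j = (H (s (t + T)) $ i $ j - H (s t) $ i $ j)
            + \<gamma> $ i * ((RC *v slice j (snd (s (t + T)))) $ i - (RC *v slice j (snd (s t))) $ i)"
          by (simp add: x right_diff_distrib)
        then show ?thesis by (simp only: h r)
      qed
      moreover have "((\<lambda>t. ((q j (t + T) - q j t) $ i - ((RC - RA) *v (Z j (t + T) - Z j t)) $ i) / (2 * \<rho> $ i)
            + \<gamma> $ i * (RC *v (Z j (t + T) - Z j t)) $ i) \<longlongrightarrow> (0 - 0) / (2 * \<rho> $ i) + \<gamma> $ i * 0) at_top"
        using rho_nonzero[of i] by (intro tendsto_intros dq dRZ) auto
      ultimately show "((\<lambda>t. (fst (s (t + T)) - fst (s t)) $ i $ j) \<longlongrightarrow> 0 $ i $ j) at_top"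
        by simp
    qed
  qed
  from tendsto_Pair[OF fst_lim snd_lim] show ?thesis by (simp add: zero_prod_def)
qed

theorem output_globally_asymptotically_stable:
  "globally_asymptotically_stable_output F H (\<chi> i. ystar)"
  unfolding globally_asymptotically_stable_output_def
proof (intro conjI allI impI)
  show "\<exists>e. equilibrium F e" by (rule equilibrium_exists)
  show "H e = (\<chi> i. ystar)" "lyapunov_stable F e" if "equilibrium F e" for e
    using that by (rule equilibrium_output equilibrium_stable)+
next
  fix s assume s: "trajectory F s"
  show "\<exists>e. equilibrium F e \<and> (s \<longlongrightarrow> e) at_top"
    by (rule trajectory_converges[OF continuous_field s trajectory_bounded[OF s]
          field_tendsto_0[OF s] equilibrium_stable])
  then obtain e where e: "equilibrium F e" "(s \<longlongrightarrow> e) at_top" by blast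
  then have "((\<lambda>t. H (s t)) \<longlongrightarrow> H e) at_top"
    using continuous_on_interior[OF continuous_output]
    by (intro isCont_tendsto_compose[of e H]) simp_all
  then show "((\<lambda>t. H (s t)) \<longlongrightarrow> (\<chi> i. ystar)) at_top"
    by (simp add: equilibrium_output[OF e(1)])
qed

end

theorem theorem32:
  fixes f :: "'N::finite \<Rightarrow> real ^ 'n::finite \<Rightarrow> real"
    and \<alpha> \<gamma> m M \<nu> \<rho> :: "real ^ 'N"
    and \<beta> :: "real ^ 'K::finite"
    and RA RC :: "real ^ 'K ^ 'N"
    and ystar :: "real ^ 'n"
  defines "Krho \<equiv> diag \<rho>"
    and "Lnu \<equiv> transpose RC ** diag \<nu> ** RC"
  assumes "\<And>i. \<alpha> $ i > 0" and "\<And>k. \<beta> $ k > 0" and "\<And>i. \<gamma> $ i \<ge> 0"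
    and "\<And>i. strongly_convex (m $ i) (f i)"
    and "\<And>i. (M $ i)-lipschitz_on UNIV (gradient (f i))"
    and "\<And>i. \<nu> $ i = \<gamma> $ i / 2"
    and "\<And>i. \<rho> $ i = m $ i - \<gamma> $ i * M $ i / 2"
    and "\<And>i. IF_OFEIP (agent_field (\<alpha> $ i) (\<gamma> $ i) (f i)) (agent_output (\<gamma> $ i))
               (\<lambda>\<xi>. 1 / (2 * \<alpha> $ i) * (\<xi> \<bullet> \<xi>)) (\<nu> $ i) (\<rho> $ i)"
    and "{v. transpose RA *v v = 0} = {c *\<^sub>R 1 | c. True}"
    and "{v. transpose RC *v v = 0} = {c *\<^sub>R 1 | c. True}"
    and "invertible Krho"
    and "positive_semidefinite
           (block_matrix (2 *\<^sub>R Krho) (RC - RA) (transpose (RC - RA)) (2 *\<^sub>R Lnu))"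
    and "\<And>c. complex_eigenvalue (diag \<beta> ** transpose RA ** matrix_inv Krho ** (RC - RA)) c
               \<Longrightarrow> c = 0 \<or> Re c > 0"
    and "is_arg_min (\<lambda>y. \<Sum>i\<in>UNIV. f i y) (\<lambda>_. True) ystar"
  shows "globally_asymptotically_stable_output
           (closed_loop_field \<alpha> \<beta> \<gamma> f RA RC) (closed_loop_output \<gamma> RC) (\<chi> i. ystar)"
proof -
  interpret optimizer_network f \<alpha> \<gamma> m M \<nu> \<rho> \<beta> RA RC ystar
    using assms(3-) unfolding Krho_def Lnu_def by unfold_locales
  show ?thesis by (rule output_globally_asymptotically_stable)
qed

end
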